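(* Let $\{p_{\boldsymbol\theta}\}$ be a $d$-parameter statistical model with parameter space $\Theta\subset\mathbb{R}^d$, satisfying (A1)--(A2) and (R1)--(R5) (listed in the context). For fixed $0<\delta<1/\sqrt{8\pi e}$ and $d<\infty$, let $M=M(\epsilon)$ be the minimal number of repetitions required to guarantee that the maximum-likelihood estimator satisfies $$\Pr\big[\|\tilde{\boldsymbol\theta}^{\mathrm{ML}}-\boldsymbol\theta\|_\infty\le\epsilon\big]\ge 1-\delta\quad\text{for all }\boldsymbol\theta\in\Theta ,$$ i.e. the minimal number $M_0$ such that this guarantee holds for all numbers of repetitions $\ge M_0$. Then, in the small-error limit $\epsilon\to0$, $$M\gtrsim W_0(\delta^{-2}/8\pi)\,\sup_{\boldsymbol\theta\in\Theta}\max_{a\in[d]}[\mathbf F_{\boldsymbol\theta}^{-1}]_{aa}\,\epsilon^{-2} .$$ Equivalently, the minimal sample complexity $N_{\mathrm{samp}}=N_{\mathcal E}M$ is lower bounded as $$N_{\mathrm{samp}}\gtrsim N_{\mathcal E}\,W_0(\delta^{-2}/8\pi)\,\sup_{\boldsymbol\theta\in\Theta}\max_{a\in[d]}[\mathbf F_{\boldsymbol\theta}^{-1}]_{aa}\,\epsilon^{-2} .$$ Here $A_\epsilon\gtrsim B_\epsilon$ means $\liminf_{\epsilon\to0}A_\epsilon/B_\epsilon\ge1$ with $\delta$ and $d$ fixed.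
   Context: Setting. $p_{\boldsymbol\theta}(x)$ is the probability of outcome $x$ in one run of a fixed quantum estimation protocol, $p_{\boldsymbol\theta}(x)=\mathrm{Tr}[\hat\Pi_x\mathcal E_{\boldsymbol\theta}(\hat\rho_0)]$, where $\hat\rho_0$ is a fixed state, $\mathcal E_{\boldsymbol\theta}$ a parametrized quantum channel that uses an elementary parameter-dependent channel a fixed number $N_{\mathcal E}$ of times, and $\{\hat\Pi_x\}_x$ a POVM. The protocol is repeated independently $M$ times, giving i.i.d. outcomes $\boldsymbol x=(x_1,\dots,x_M)$ with law $\prod_i p_{\boldsymbol\theta}(x_i)$, $\boldsymbol\theta$ being the true parameter; $\Pr$ and $\mathbb E_{\boldsymbol\theta}$ refer to this law, and $X$ denotes a single outcome. The sample complexity is $N_{\mathrm{samp}}=MN_{\mathcal E}$. Notation. $[d]=\{1,\dots,d\}$. $\ell_{\boldsymbol\theta}(x)=\log p_{\boldsymbol\theta}(x)$, with gradient $\ell^{(1)}_{\boldsymbol\theta}(x)\in\mathbb R^d$, Hessian $\ell^{(2)}_{\boldsymbol\theta}(x)\in\mathbb R^{d\times d}$ and third-derivative tensor $\ell^{(3)}_{\boldsymbol\theta}(x)\in\mathbb R^{d\times d\times d}$ with respect to $\boldsymbol\theta$; $\ell_{\boldsymbol\theta}(\boldsymbol x)=\sum_{i=1}^M\ell_{\boldsymbol\theta}(x_i)$. The Fisher information matrix is $\mathbf F_{\boldsymbol\theta}=\mathbb E_{\boldsymbol\theta}[\ell^{(1)}_{\boldsymbol\theta}(X)\ell^{(1)}_{\boldsymbol\theta}(X)^{\mathsf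 T}]$, with $\mathbb E_{\boldsymbol\theta}[\ell^{(1)}_{\boldsymbol\theta}(X)]=0$ and $\mathbb E_{\boldsymbol\theta}[\ell^{(2)}_{\boldsymbol\theta}(X)]=-\mathbf F_{\boldsymbol\theta}$. $\tilde{\boldsymbol\theta}^{\mathrm{ML}}=\tilde{\boldsymbol\theta}^{\mathrm{ML}}(\boldsymbol x)$ is the maximizer of $\boldsymbol\theta\mapsto\ell_{\boldsymbol\theta}(\boldsymbol x)$ over $\Theta$. $\|\boldsymbol v\|_\infty=\max_i|v_i|$ and $\|\cdot\|_2$ is the Euclidean norm. $\|\cdot\|_{\mathrm{op}}$ is the Euclidean operator norm for matrices, and for a third-order tensor $\mathbf T$ it is $\sup|\sum_{ijk}T_{ijk}u_iv_jw_k|$ over Euclidean unit vectors $u,v,w$. $W_0$ is the principal branch of the Lambert $W$ function. Assumptions. (A1) Unique maximizer and stationary point: $\ell_{\boldsymbol\theta}(\boldsymbol x)$ has a unique maximizer $\tilde{\boldsymbol\theta}^{\mathrm{ML}}$ in the interior of the parameter domain $\Theta$, which is also the unique stationary point. (A2) Smoothness: $\ell_{\boldsymbol\theta}(\boldsymbol x)$ is three times continuously differentiable with respect to $\boldsymbol\theta$ on the parameter domain $\Theta$. (R1) Let $\widetilde\Theta$ be an open ambient parameter domain containing $\Theta$. There exists $r_0>0$ such that $\boldsymbol\theta+\boldsymbol\Delta\in\widetilde\Theta$ for all $\boldsymbol\theta\in\Theta$ and $\|\boldsymbol\Delta\|_2\le r_0$. (R2) $\mathbf F_{\boldsymbol\theta}$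 is non-singular for every $\boldsymbol\theta\in\Theta$ and $\sup_{\boldsymbol\theta\in\Theta}\|\mathbf F_{\boldsymbol\theta}^{-1}\|_{\mathrm{op}}<\infty$. (R3) $\sup_{\boldsymbol\theta\in\Theta}\mathbb E_{\boldsymbol\theta}[\mathrm{Tr}\{(\ell^{(2)}_{\boldsymbol\theta}(X)+\mathbf F_{\boldsymbol\theta})^2\}]<\infty$. (R4) $\sup_{\boldsymbol\theta\in\Theta}\mathbb E_{\boldsymbol\theta}[(\sup_{\|\boldsymbol\Delta\|_2\le r_0}\|\ell^{(3)}_{\boldsymbol\theta+\boldsymbol\Delta}(X)\|_{\mathrm{op}})^2]<\infty$. (R5) $\sup_{\boldsymbol\theta\in\Theta}\sup_{\|\boldsymbol u\|_2=1}\dfrac{\mathbb E_{\boldsymbol\theta}[|\boldsymbol u^{\mathsf T}\mathbf F_{\boldsymbol\theta}^{-1}\ell^{(1)}_{\boldsymbol\theta}(X)|^3]}{(\boldsymbol u^{\mathsf T}\mathbf F_{\boldsymbol\theta}^{-1}\boldsymbol u)^{3/2}}<\infty$. *)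

theory Defs
  imports "HOL-Probability.Probability"
begin

section \<open>Analytic notions\<close>

text \<open>Principal branch of the Lambert function; meaningful for \<open>x \<ge> - exp (-1)\<close>.\<close>
definition lambert_W0 :: "real \<Rightarrow> real" where
  "lambert_W0 x = (THE w. - 1 \<le> w \<and> w * exp w = x)"

definition partial_deriv :: "'d::finite \<Rightarrow> (real^'d \<Rightarrow> real) \<Rightarrow> real^'d \<Rightarrow> real" where
  "partial_deriv i f \<theta> = frechet_derivative f (at \<theta>) (axis i 1)"

definition gradient :: "(real^'d::finite \<Rightarrow> real) \<Rightarrow> real^'d \<Rightarrow> real^'d" where
  "gradient f \<theta> = (\<chi> i. partial_deriv i f \<theta>)"

definition hessian :: "(real^'d::finite \<Rightarrow> real) \<Rightarrow> real^'d \<Rightarrow> real^'d^'d" where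
  "hessian f \<theta> = (\<chi> i j. partial_deriv i (partial_deriv j f) \<theta>)"

definition third_derivs :: "(real^'d::finite \<Rightarrow> real) \<Rightarrow> real^'d \<Rightarrow> real^'d^'d^'d" where
  "third_derivs f \<theta> = (\<chi> i j k. partial_deriv i (partial_deriv j (partial_deriv k f)) \<theta>)"

text \<open>\<open>k\<close> times continuously differentiable; only used on open sets \<open>S\<close>, where the
  two-sided derivatives in \<^const>\<open>partial_deriv\<close> are the appropriate ones.\<close>
fun Ck_on :: "nat \<Rightarrow> (real^'d::finite \<Rightarrow> real) \<Rightarrow> (real^'d) set \<Rightarrow> bool" where
  "Ck_on 0 f S \<longleftrightarrow> continuous_on S f"
| "Ck_on (Suc k) f S \<longleftrightarrow> f differentiable_on S \<and> (\<forall>i. Ck_on k (partial_deriv i f) S)"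

definition tensor3_onorm :: "real^'d^'d^'d::finite \<Rightarrow> real" where
  "tensor3_onorm T =
     (SUP (u, v, w) \<in> sphere 0 1 \<times> sphere 0 1 \<times> sphere 0 1.
        \<bar>\<Sum>i\<in>UNIV. \<Sum>j\<in>UNIV. \<Sum>k\<in>UNIV. T $ i $ j $ k * u $ i * v $ j * w $ k\<bar>)"

text \<open>The asymptotic relation \<open>A\<^sub>\<epsilon> \<greatersim> B\<^sub>\<epsilon>\<close> as \<open>\<epsilon> \<rightarrow> 0\<close>, \<open>\<epsilon> > 0\<close>. The left-hand side may be infinite.\<close>
definition asymp_ge :: "(real \<Rightarrow> ereal) \<Rightarrow> (real \<Rightarrow> real) \<Rightarrow> bool" where
  "asymp_ge A B \<longleftrightarrow> 1 \<le> Liminf (at_right 0) (\<lambda>\<epsilon>. A \<epsilon> / ereal (B \<epsilon>))"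

section \<open>Statistical models\<close>

text \<open>A model is a family of densities \<open>p \<theta>\<close> with respect to a dominating measure \<open>\<nu>\<close> on the
  outcomes. If \<open>\<nu>\<close> is a counting measure, \<open>p \<theta> x\<close> is the probability of the outcome \<open>x\<close>.\<close>

definition law :: "'x measure \<Rightarrow> (real^'d::finite \<Rightarrow> 'x \<Rightarrow> real) \<Rightarrow> real^'d \<Rightarrow> 'x measure" where
  "law \<nu> p \<theta> = density \<nu> (\<lambda>x. ennreal (p \<theta> x))"

definition samples :: "'x measure \<Rightarrow> nat \<Rightarrow> (nat \<Rightarrow> 'x) set" where
  "samples \<nu> M = space (\<Pi>\<^sub>M i\<in>{..<M}. \<nu>)"

definition sample_law ::
  "'x measure \<Rightarrow> (real^'d::finite \<Rightarrow> 'x \<Rightarrow> real) \<Rightarrow> nat \<Rightarrow> real^'d \<Rightarrow> (nat \<Rightarrow> 'x) measure" where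
  "sample_law \<nu> p M \<theta> = (\<Pi>\<^sub>M i\<in>{..<M}. law \<nu> p \<theta>)"

definition loglik1 :: "(real^'d::finite \<Rightarrow> 'x \<Rightarrow> real) \<Rightarrow> 'x \<Rightarrow> real^'d \<Rightarrow> real" where
  "loglik1 p x \<theta> = ln (p \<theta> x)"

definition loglik ::
  "(real^'d::finite \<Rightarrow> 'x \<Rightarrow> real) \<Rightarrow> nat \<Rightarrow> (nat \<Rightarrow> 'x) \<Rightarrow> real^'d \<Rightarrow> real" where
  "loglik p M xs \<theta> = (\<Sum>i<M. loglik1 p (xs i) \<theta>)"

definition fisher ::
  "'x measure \<Rightarrow> (real^'d::finite \<Rightarrow> 'x \<Rightarrow> real) \<Rightarrow> real^'d \<Rightarrow> real^'d^'d" where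
  "fisher \<nu> p \<theta> =
     (\<chi> i j. \<integral>x. gradient (loglik1 p x) \<theta> $ i * gradient (loglik1 p x) \<theta> $ j \<partial>law \<nu> p \<theta>)"

abbreviation fisher_inv ::
  "'x measure \<Rightarrow> (real^'d::finite \<Rightarrow> 'x \<Rightarrow> real) \<Rightarrow> real^'d \<Rightarrow> real^'d^'d" where
  "fisher_inv \<nu> p \<theta> \<equiv> matrix_inv (fisher \<nu> p \<theta>)"

definition mle ::
  "(real^'d::finite \<Rightarrow> 'x \<Rightarrow> real) \<Rightarrow> (real^'d) set \<Rightarrow> nat \<Rightarrow> (nat \<Rightarrow> 'x) \<Rightarrow> real^'d" where
  "mle p \<Theta> M xs = arg_max (loglik p M xs) (\<lambda>\<theta>. \<theta> \<in> \<Theta>)"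

text \<open>When the maximizer over \<open>\<Theta>\<close> is unique and interior for every sample, and the log-likelihood is
  continuous, the event below is measurable: the interior of \<open>\<Theta>\<close> is a countable union of compact
  sets, over which suprema may be taken along countable dense subsets.\<close>
definition mle_guarantee ::
  "'x measure \<Rightarrow> (real^'d::finite \<Rightarrow> 'x \<Rightarrow> real) \<Rightarrow> (real^'d) set \<Rightarrow> real \<Rightarrow> real \<Rightarrow> nat \<Rightarrow> bool" where
  "mle_guarantee \<nu> p \<Theta> \<delta> \<epsilon> M \<longleftrightarrow>
     (\<forall>\<theta>\<in>\<Theta>. measure (sample_law \<nu> p M \<theta>)
                {xs \<in> samples \<nu> M. infnorm (mle p \<Theta> M xs - \<theta>) \<le> \<epsilon>} \<ge> 1 - \<delta>)"

text \<open>This is \<open>\<infinity>\<close> if no number of repetitions suffices.\<close>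
definition min_reps ::
  "'x measure \<Rightarrow> (real^'d::finite \<Rightarrow> 'x \<Rightarrow> real) \<Rightarrow> (real^'d) set \<Rightarrow> real \<Rightarrow> real \<Rightarrow> enat" where
  "min_reps \<nu> p \<Theta> \<delta> \<epsilon> =
     Inf (enat ` {M\<^sub>0. 1 \<le> M\<^sub>0 \<and> (\<forall>M\<ge>M\<^sub>0. mle_guarantee \<nu> p \<Theta> \<delta> \<epsilon> M)})"

definition min_sample_complexity ::
  "nat \<Rightarrow> 'x measure \<Rightarrow> (real^'d::finite \<Rightarrow> 'x \<Rightarrow> real) \<Rightarrow> (real^'d) set \<Rightarrow> real \<Rightarrow> real \<Rightarrow> enat" where
  "min_sample_complexity N \<nu> p \<Theta> \<delta> \<epsilon> = enat N * min_reps \<nu> p \<Theta> \<delta> \<epsilon>"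

section \<open>Regularity assumptions\<close>

text \<open>\<open>\<Theta>'\<close> is the open ambient parameter domain. Derivatives of the log-likelihood are evaluated
  at points within distance \<open>r\<^sub>0\<close> of \<open>\<Theta>\<close>, so the densities live, and smoothness is required, on
  \<open>\<Theta>'\<close>; normalisation is only required on \<open>\<Theta>\<close>. The identities \<open>score_mean\<close> and \<open>hessian_mean\<close>
  are the usual consequences of differentiating the normalisation under the integral. The suprema
  in \<open>R3\<close> to \<open>R5\<close> are taken in \<^typ>\<open>ennreal\<close>, so finiteness includes integrability.\<close>

locale regular_model =
  fixes \<nu> :: "'x measure" and p :: "real^'d::finite \<Rightarrow> 'x \<Rightarrow> real"
    and \<Theta> \<Theta>' :: "(real^'d) set" and r\<^sub>0 :: real
  assumes dominating: "sigma_finite_measure \<nu>"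
    and nonempty: "\<Theta> \<noteq> {}"
    and density_measurable: "\<And>\<theta>. \<theta> \<in> \<Theta>' \<Longrightarrow> p \<theta> \<in> borel_measurable \<nu>"
    and density_pos: "\<And>\<theta> x. \<theta> \<in> \<Theta>' \<Longrightarrow> x \<in> space \<nu> \<Longrightarrow> p \<theta> x > 0"
    and prob: "\<And>\<theta>. \<theta> \<in> \<Theta> \<Longrightarrow> prob_space (law \<nu> p \<theta>)"
    and score_integrable: "\<And>\<theta>. \<theta> \<in> \<Theta> \<Longrightarrow> integrable (law \<nu> p \<theta>) (\<lambda>x. gradient (loglik1 p x) \<theta>)"
    and score_sq_integrable: "\<And>\<theta>. \<theta> \<in> \<Theta> \<Longrightarrow>
          integrable (law \<nu> p \<theta>) (\<lambda>x. (norm (gradient (loglik1 p x) \<theta>))\<^sup>2)"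
    and hessian_integrable: "\<And>\<theta>. \<theta> \<in> \<Theta> \<Longrightarrow> integrable (law \<nu> p \<theta>) (\<lambda>x. hessian (loglik1 p x) \<theta>)"
    and score_mean: "\<And>\<theta>. \<theta> \<in> \<Theta> \<Longrightarrow> (\<integral>x. gradient (loglik1 p x) \<theta> \<partial>law \<nu> p \<theta>) = 0"
    and hessian_mean: "\<And>\<theta>. \<theta> \<in> \<Theta> \<Longrightarrow>
          (\<integral>x. hessian (loglik1 p x) \<theta> \<partial>law \<nu> p \<theta>) = - fisher \<nu> p \<theta>"
    and A1: "\<And>M xs. 1 \<le> M \<Longrightarrow> xs \<in> samples \<nu> M \<Longrightarrow>
          \<exists>\<theta>\<^sub>M \<in> interior \<Theta>.
            {\<theta>. is_arg_max (loglik p M xs) (\<lambda>\<theta>. \<theta> \<in> \<Theta>) \<theta>} = {\<theta>\<^sub>M} \<and>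
            {\<theta> \<in> \<Theta>. gradient (loglik p M xs) \<theta> = 0} = {\<theta>\<^sub>M}"
    and A2: "\<And>M xs. 1 \<le> M \<Longrightarrow> xs \<in> samples \<nu> M \<Longrightarrow> Ck_on 3 (loglik p M xs) \<Theta>'"
    and R1: "open \<Theta>'" "\<Theta> \<subseteq> \<Theta>'" "0 < r\<^sub>0"
          "\<And>\<theta> \<Delta>. \<theta> \<in> \<Theta> \<Longrightarrow> norm \<Delta> \<le> r\<^sub>0 \<Longrightarrow> \<theta> + \<Delta> \<in> \<Theta>'"
    and R2: "\<And>\<theta>. \<theta> \<in> \<Theta> \<Longrightarrow> invertible (fisher \<nu> p \<theta>)"
          "bdd_above ((\<lambda>\<theta>. onorm (\<lambda>v. fisher_inv \<nu> p \<theta> *v v)) ` \<Theta>)"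
    and R3: "(SUP \<theta>\<in>\<Theta>. \<integral>\<^sup>+x. ennreal (trace
                ((hessian (loglik1 p x) \<theta> + fisher \<nu> p \<theta>) **
                 (hessian (loglik1 p x) \<theta> + fisher \<nu> p \<theta>))) \<partial>law \<nu> p \<theta>) < \<infinity>"
    and R4: "(SUP \<theta>\<in>\<Theta>. \<integral>\<^sup>+x. (SUP \<Delta>\<in>cball 0 r\<^sub>0.
                ennreal (tensor3_onorm (third_derivs (loglik1 p x) (\<theta> + \<Delta>))))\<^sup>2 \<partial>law \<nu> p \<theta>) < \<infinity>"
    and R5: "(SUP \<theta>\<in>\<Theta>. SUP u\<in>sphere 0 1.
                (\<integral>\<^sup>+x. ennreal (\<bar>u \<bullet> (fisher_inv \<nu> p \<theta> *v gradient (loglik1 p x) \<theta>)\<bar> ^ 3) \<partial>law \<nu> p \<theta>)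
                / ennreal ((u \<bullet> (fisher_inv \<nu> p \<theta> *v u)) powr (3/2))) < \<infinity>"

end

theory Submission
  imports Defs "HOL-Real_Asymp.Real_Asymp"
begin

text \<open>
  Fix \<open>\<theta>\<close> and a coordinate \<open>a\<close>, and let \<open>u\<close> be the \<open>a\<close>-th column of \<open>F\<^sub>\<theta>\<inverse>\<close>. On the event that the
  estimator is within \<open>\<epsilon>\<close> of \<open>\<theta>\<close>, a Taylor expansion of the likelihood equation shows that the
  averaged score in direction \<open>u\<close> equals the \<open>a\<close>-th estimation error up to \<open>o(\<epsilon>)\<close>: the averaged Hessian
  concentrates by the weak law of large numbers, and the third-order term is bounded in
  probability by Markov's inequality. In particular no separate consistency argument is needed. The
  averaged score has variance \<open>[F\<^sub>\<theta>\<inverse>]\<^sub>a\<^sub>a / M\<close>, so by the central limit theorem, if \<open>M \<epsilon>\<^sup>2\<close> is close to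
  \<open>\<kappa> < W\<^sub>0 [F\<^sub>\<theta>\<inverse>]\<^sub>a\<^sub>a\<close>, the success probability is asymptotically at most \<open>\<Phi>(t)\<close> for some \<open>t\<close> with
  \<open>1 < t < \<surd>W\<^sub>0\<close>. The Mills-ratio bound \<open>1 - \<Phi>(t) \<ge> \<phi>(t) / (2 t)\<close> for \<open>t \<ge> 1\<close> then makes the failure
  probability exceed \<open>\<phi>(\<surd>W\<^sub>0) / (2 \<surd>W\<^sub>0)\<close>, which is \<open>\<delta>\<close> by definition of \<open>W\<^sub>0\<close>; the hypothesis on \<open>\<delta>\<close> says
  exactly that \<open>W\<^sub>0 > 1\<close>.
\<close>

section \<open>Limit theorems for independent samples\<close>

context prob_space
begin

text \<open>All sample sizes share one infinite product space, since the central limit theorem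
  speaks of a single sequence of random variables. \<open>mle_guarantee_sequences\<close> later
  transfers finite samples to it by restriction.\<close>

lemma prob_space_sequences: "prob_space (\<Pi>\<^sub>M j\<in>(UNIV::nat set). M)"
  by (intro prob_space_PiM prob_space_axioms)

lemma distr_component_sequences:
  assumes [measurable]: "f \<in> measurable M N"
  shows "distr (\<Pi>\<^sub>M j\<in>(UNIV::nat set). M) N (\<lambda>\<omega>. f (\<omega> i)) = distr M N f"
proof -
  have "distr M N f = distr (distr (\<Pi>\<^sub>M j\<in>(UNIV::nat set). M) M (\<lambda>\<omega>. \<omega> i)) N f"
    by (subst distr_PiM_component) (auto intro: prob_space_axioms)
  also have "\<dots> = distr (\<Pi>\<^sub>M j\<in>(UNIV::nat set). M) N (\<lambda>\<omega>. f (\<omega> i))"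
    by (subst distr_distr) (auto simp: comp_def)
  finally show ?thesis ..
qed

lemma indep_vars_sequences:
  assumes f: "f \<in> measurable M N"
  shows "prob_space.indep_vars (\<Pi>\<^sub>M j\<in>(UNIV::nat set). M) (\<lambda>_. N) (\<lambda>i \<omega>. f (\<omega> i)) UNIV"
proof -
  let ?P = "\<Pi>\<^sub>M j\<in>(UNIV::nat set). M"
  interpret P: prob_space ?P by (rule prob_space_sequences)
  have "P.indep_vars (\<lambda>_. M) (\<lambda>i \<omega>. \<omega> i) UNIV"
  proof (subst P.indep_vars_iff_distr_eq_PiM')
    have "distr ?P ?P (\<lambda>x. \<lambda>i\<in>UNIV. x i) = distr ?P ?P (\<lambda>x. x)"
      by (intro distr_cong) auto
    also have "\<dots> = ?P" by simp
    also have "\<dots> = (\<Pi>\<^sub>M i\<in>UNIV. distr ?P M (\<lambda>\<omega>. \<omega> i))"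
      by (subst distr_PiM_component) (auto intro: prob_space_axioms)
    finally show "distr ?P ?P (\<lambda>x. \<lambda>i\<in>UNIV. x i) = (\<Pi>\<^sub>M i\<in>UNIV. distr ?P M (\<lambda>\<omega>. \<omega> i))" .
  qed auto
  from P.indep_vars_compose2[OF this, of "\<lambda>_. f" "\<lambda>_. N"] f show ?thesis by simp
qed

lemma
  fixes f :: "'a \<Rightarrow> real"
  assumes [measurable]: "f \<in> borel_measurable M"
  shows integrable_component_iff:
      "integrable (\<Pi>\<^sub>M j\<in>(UNIV::nat set). M) (\<lambda>\<omega>. f (\<omega> i)) \<longleftrightarrow> integrable M f"
    and integral_component: "(\<integral>\<omega>. f (\<omega> i) \<partial>(\<Pi>\<^sub>M j\<in>(UNIV::nat set). M)) = expectation f"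
proof -
  let ?P = "\<Pi>\<^sub>M j\<in>(UNIV::nat set). M"
  have d: "distr ?P M (\<lambda>\<omega>. \<omega> i) = M"
    by (rule distr_PiM_component) (auto intro: prob_space_axioms)
  show "integrable ?P (\<lambda>\<omega>. f (\<omega> i)) \<longleftrightarrow> integrable M f"
    using integrable_distr_eq[of "\<lambda>\<omega>. \<omega> i" ?P M f] by (simp add: d)
  show "(\<integral>\<omega>. f (\<omega> i) \<partial>?P) = expectation f"
    using integral_distr[of "\<lambda>\<omega>. \<omega> i" ?P M f] by (simp add: d)
qed

lemma nn_integral_component:
  assumes [measurable]: "f \<in> borel_measurable M"
  shows "(\<integral>\<^sup>+\<omega>. f (\<omega> i) \<partial>(\<Pi>\<^sub>M j\<in>(UNIV::nat set). M)) = (\<integral>\<^sup>+x. f x \<partial>M)"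
proof -
  let ?P = "\<Pi>\<^sub>M j\<in>(UNIV::nat set). M"
  have d: "distr ?P M (\<lambda>\<omega>. \<omega> i) = M"
    by (rule distr_PiM_component) (auto intro: prob_space_axioms)
  show ?thesis
    using nn_integral_distr[of "\<lambda>\<omega>. \<omega> i" ?P M f] by (simp add: d)
qed

text \<open>Markov's inequality, kept in \<open>ennreal\<close> so that \<open>B\<close> may take
  the value infinity at some points. The bound is free of \<open>n\<close>, which lets the level
  \<open>c\<close> vary together with the sample size.\<close>

lemma tail_average_le:
  fixes B :: "'a \<Rightarrow> ennreal"
  assumes [measurable]: "B \<in> borel_measurable M" and fin: "(\<integral>\<^sup>+x. B x \<partial>M) < \<infinity>"
    and "0 < c" "0 < n"
  shows "measure (\<Pi>\<^sub>M j\<in>(UNIV::nat set). M)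
           {\<omega> \<in> space (\<Pi>\<^sub>M j\<in>(UNIV::nat set). M). ennreal (real n * c) \<le> (\<Sum>i<n. B (\<omega> i))}
         \<le> enn2real (\<integral>\<^sup>+x. B x \<partial>M) / c"
proof -
  let ?P = "\<Pi>\<^sub>M j\<in>(UNIV::nat set). M"
  interpret P: prob_space ?P by (rule prob_space_sequences)
  define E where "E = enn2real (\<integral>\<^sup>+x. B x \<partial>M)"
  have E: "(\<integral>\<^sup>+x. B x \<partial>M) = ennreal E" and "0 \<le> E" using fin by (simp_all add: E_def)
  let ?S = "\<lambda>\<omega>. \<Sum>i<n. B (\<omega> i)"
  have [measurable]: "?S \<in> borel_measurable ?P" by measurable
  have pos: "0 < real n * c" using assms by simp
  have int: "(\<integral>\<^sup>+\<omega>. ?S \<omega> \<partial>?P) = ennreal (real n * E)"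
    using \<open>0 \<le> E\<close> by (subst nn_integral_sum)
      (simp_all add: nn_integral_component E ennreal_of_nat_eq_real_of_nat flip: ennreal_mult)
  have "{\<omega> \<in> space ?P. ennreal (real n * c) \<le> ?S \<omega>} \<subseteq>
      {\<omega> \<in> space ?P. 1 \<le> ennreal (1 / (real n * c)) * ?S \<omega>}"
  proof safe
    fix \<omega> assume "ennreal (real n * c) \<le> ?S \<omega>"
    then have "ennreal (1 / (real n * c)) * ennreal (real n * c) \<le> ennreal (1 / (real n * c)) * ?S \<omega>"
      by (intro mult_left_mono) auto
    then show "1 \<le> ennreal (1 / (real n * c)) * ?S \<omega>"
      using pos by (subst (asm) ennreal_mult''[symmetric]) (auto split: if_splits)
  qed
  then have "emeasure ?P {\<omega> \<in> space ?P. ennreal (real n * c) \<le> ?S \<omega>}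
     \<le> emeasure ?P {\<omega> \<in> space ?P. 1 \<le> ennreal (1 / (real n * c)) * ?S \<omega>}"
    by (intro emeasure_mono) measurable
  also have "\<dots> \<le> ennreal (1 / (real n * c)) * (\<integral>\<^sup>+\<omega>. ?S \<omega> * indicator (space ?P) \<omega> \<partial>?P)"
    by (intro nn_integral_Markov_inequality) measurable
  also have "(\<integral>\<^sup>+\<omega>. ?S \<omega> * indicator (space ?P) \<omega> \<partial>?P) = (\<integral>\<^sup>+\<omega>. ?S \<omega> \<partial>?P)"
    by (intro nn_integral_cong) auto
  also have "ennreal (1 / (real n * c)) * \<dots> = ennreal (E / c)"
    unfolding int using assms pos \<open>0 \<le> E\<close> by (subst ennreal_mult''[symmetric]) auto
  finally show ?thesis
    using \<open>0 < c\<close> \<open>0 \<le> E\<close> by (simp add: P.emeasure_eq_measure E_def)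
qed

text \<open>At each point the truncations eventually equal \<open>f\<close>, and their error is
  dominated by the absolute value of \<open>f\<close>, so dominated convergence applies.\<close>

lemma truncation_L1:
  fixes f :: "'a \<Rightarrow> real"
  assumes f: "integrable M f" and "0 < \<kappa>"
  obtains K where "0 < K" "expectation (\<lambda>x. \<bar>f x - max (- K) (min K (f x))\<bar>) < \<kappa>"
proof -
  have [measurable]: "f \<in> borel_measurable M" using f by simp
  have "(\<lambda>k. expectation (\<lambda>x. \<bar>f x - max (- real k) (min (real k) (f x))\<bar>)) \<longlonglongrightarrow> expectation (\<lambda>x. 0)"
  proof (rule integral_dominated_convergence[where w = "\<lambda>x. \<bar>f x\<bar>"])
    show "AE x in M. (\<lambda>k. \<bar>f x - max (- real k) (min (real k) (f x))\<bar>) \<longlonglongrightarrow> 0"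
    proof (intro AE_I2 tendsto_eventually)
      fix x
      obtain k0 where "\<bar>f x\<bar> \<le> real k0" using real_arch_simple by blast
      then show "\<forall>\<^sub>F k in sequentially. \<bar>f x - max (- real k) (min (real k) (f x))\<bar> = 0"
        by (intro eventually_sequentiallyI[of k0]) auto
    qed
  qed (use f in \<open>auto simp: max_def min_def\<close>)
  then have "\<forall>\<^sub>F k in sequentially. expectation (\<lambda>x. \<bar>f x - max (- real k) (min (real k) (f x))\<bar>) < \<kappa>"
    using \<open>0 < \<kappa>\<close> by (intro order_tendstoD) auto
  with eventually_gt_at_top[of 0]
  have "\<forall>\<^sub>F k in sequentially. 0 < k \<and> expectation (\<lambda>x. \<bar>f x - max (- real k) (min (real k) (f x))\<bar>) < \<kappa>"
    by eventually_elim auto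
  then obtain k where "0 < k" "expectation (\<lambda>x. \<bar>f x - max (- real k) (min (real k) (f x))\<bar>) < \<kappa>"
    using eventually_happens'[OF sequentially_bot] by blast
  then show ?thesis by (intro that[of "real k"]) auto
qed

text \<open>With only a first moment at hand, \<open>f\<close> is truncated: Hoeffding's inequality
  controls the bounded part and Markov's inequality the remainder, which is small in mean.\<close>

lemma weak_law_of_large_numbers:
  fixes f :: "'a \<Rightarrow> real"
  assumes f: "integrable M f" and \<eta>: "0 < \<eta>"
  shows "(\<lambda>n. measure (\<Pi>\<^sub>M j\<in>(UNIV::nat set). M)
           {\<omega> \<in> space (\<Pi>\<^sub>M j\<in>(UNIV::nat set). M).
             real n * \<eta> \<le> \<bar>(\<Sum>i<n. f (\<omega> i)) - real n * expectation f\<bar>}) \<longlonglongrightarrow> 0"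
proof -
  let ?P = "\<Pi>\<^sub>M j\<in>(UNIV::nat set). M"
  interpret P: prob_space ?P by (rule prob_space_sequences)
  have [measurable]: "f \<in> borel_measurable M" using f by simp
  let ?bad = "\<lambda>n. {\<omega> \<in> space ?P. real n * \<eta> \<le> \<bar>(\<Sum>i<n. f (\<omega> i)) - real n * expectation f\<bar>}"
  show ?thesis
  proof (rule tendstoI)
    fix \<tau> :: real assume \<tau>: "0 < \<tau>"
    \<comment> \<open>The first bound keeps the shift of the mean below \<open>\<eta> / 3\<close>;
      the second makes the Markov term at most \<open>\<tau> / 2\<close>.\<close>
    define \<kappa> where "\<kappa> = min (\<eta> / 3) (\<tau> * \<eta> / 6)"
    have "0 < \<kappa>" using \<eta> \<tau> by (simp add: \<kappa>_def)
    from truncation_L1[OF f this] obtain K where K: "0 < K"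
      "expectation (\<lambda>x. \<bar>f x - max (- K) (min K (f x))\<bar>) < \<kappa>" .
    define g where "g x = max (- K) (min K (f x))" for x
    define h where "h x = \<bar>f x - g x\<bar>" for x
    have [measurable]: "g \<in> borel_measurable M" unfolding g_def by measurable
    have [measurable]: "h \<in> borel_measurable M" unfolding h_def by measurable
    have g: "integrable M g"
      by (rule integrable_const_bound[of _ K]) (use K in \<open>auto simp: g_def\<close>)
    have h: "integrable M h" unfolding h_def using f g by simp
    have Eh: "expectation h < \<kappa>" using K(2) unfolding h_def[abs_def] g_def .
    have fg: "\<bar>expectation f - expectation g\<bar> \<le> expectation h"
      unfolding h_def using f g integral_abs_bound[of M "\<lambda>x. f x - g x"] by simp
    have bound: "measure ?P (?bad n) \<le> 2 * exp (- (\<eta>\<^sup>2 / (18 * K\<^sup>2)) * real n) + \<tau> / 2"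
      if n: "0 < n" for n
    proof -
      \<comment> \<open>A deviation of \<open>n * \<eta>\<close> is shared in thirds between the
        truncated sum, the truncation error and the shift of the mean. The last never uses up its
        share, so one of the first two must.\<close>
      let ?G = "{\<omega> \<in> space ?P. real n * \<eta> / 3 \<le> \<bar>(\<Sum>i<n. g (\<omega> i)) - real n * expectation g\<bar>}"
      let ?H = "{\<omega> \<in> space ?P. real n * \<eta> / 3 \<le> (\<Sum>i<n. h (\<omega> i))}"
      have "?bad n \<subseteq> ?G \<union> ?H"
      proof safe
        fix \<omega> assume a: "real n * \<eta> \<le> \<bar>(\<Sum>i<n. f (\<omega> i)) - real n * expectation f\<bar>"
          and b: "\<not> real n * \<eta> / 3 \<le> (\<Sum>i<n. h (\<omega> i))"
        have "\<bar>(\<Sum>i<n. f (\<omega> i)) - (\<Sum>i<n. g (\<omega> i))\<bar> \<le> (\<Sum>i<n. h (\<omega> i))"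
          unfolding sum_subtractf[symmetric] h_def by (rule sum_abs)
        moreover have "\<bar>real n * expectation f - real n * expectation g\<bar> \<le> real n * (\<eta> / 3)"
          unfolding right_diff_distrib[symmetric] abs_mult
          using fg Eh n by (intro mult_mono) (auto simp: \<kappa>_def)
        ultimately show "real n * \<eta> / 3 \<le> \<bar>(\<Sum>i<n. g (\<omega> i)) - real n * expectation g\<bar>"
          using a b by (simp add: abs_le_iff abs_if split: if_splits)
      qed
      then have "measure ?P (?bad n) \<le> measure ?P (?G \<union> ?H)"
        by (intro P.finite_measure_mono) measurable
      also have "\<dots> \<le> measure ?P ?G + measure ?P ?H"
        by (intro measure_Un_le) measurable
      also have "measure ?P ?G \<le> 2 * exp (- 2 * (real n * \<eta> / 3)\<^sup>2 / (\<Sum>i<n. (K - - K)\<^sup>2))"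
      proof -
        interpret H: Hoeffding_ineq ?P "{..<n}" "\<lambda>i \<omega>. g (\<omega> i)" "\<lambda>_. - K" "\<lambda>_. K"
          "\<Sum>i<n. P.expectation (\<lambda>\<omega>. g (\<omega> i))"
        proof unfold_locales
          show "P.indep_vars (\<lambda>_. borel) (\<lambda>i \<omega>. g (\<omega> i)) {..<n}"
            using indep_vars_sequences[of g borel] by (rule P.indep_vars_subset) auto
        qed (use K in \<open>auto simp: g_def\<close>)
        show ?thesis
          using H.Hoeffding_ineq_abs_ge[of "real n * \<eta> / 3"] n \<eta> K by (simp add: integral_component)
      qed
      also have "- 2 * (real n * \<eta> / 3)\<^sup>2 / (\<Sum>i<n. (K - - K)\<^sup>2) = - (\<eta>\<^sup>2 / (18 * K\<^sup>2)) * real n"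
        using n K by (simp add: field_simps power2_eq_square)
      also have "measure ?P ?H \<le> (\<integral>\<omega>. (\<Sum>i<n. h (\<omega> i)) \<partial>?P) / (real n * \<eta> / 3)"
      proof (rule integral_Markov_inequality_measure[where A = "space ?P"])
        show "integrable ?P (\<lambda>\<omega>. \<Sum>i<n. h (\<omega> i))"
          by (intro Bochner_Integration.integrable_sum) (simp add: integrable_component_iff h)
      qed (use n \<eta> in \<open>auto simp: h_def intro!: sum_nonneg\<close>)
      also have "(\<integral>\<omega>. (\<Sum>i<n. h (\<omega> i)) \<partial>?P) = real n * expectation h"
        by (subst Bochner_Integration.integral_sum) (auto simp: integrable_component_iff h integral_component)
      also have "real n * expectation h / (real n * \<eta> / 3) \<le> \<tau> / 2"
        using n \<eta> Eh by (simp add: \<kappa>_def field_simps)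
      finally show ?thesis by simp
    qed
    have "(\<lambda>n. 2 * exp (- (\<eta>\<^sup>2 / (18 * K\<^sup>2)) * real n) + \<tau> / 2) \<longlonglongrightarrow> 2 * 0 + \<tau> / 2"
    proof (intro tendsto_intros filterlim_compose[OF exp_at_bot] filterlim_real_sequentially
        filterlim_tendsto_neg_mult_at_bot[OF tendsto_const])
      show "- (\<eta>\<^sup>2 / (18 * K\<^sup>2)) < 0" using \<eta> K by simp
    qed
    then have "\<forall>\<^sub>F n in sequentially. 2 * exp (- (\<eta>\<^sup>2 / (18 * K\<^sup>2)) * real n) + \<tau> / 2 < \<tau>"
      by (rule order_tendstoD) (use \<tau> in simp)
    with eventually_gt_at_top[of 0]
    show "\<forall>\<^sub>F n in sequentially. dist (measure ?P (?bad n)) 0 < \<tau>"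
    proof eventually_elim
      case (elim n)
      then show ?case using bound[of n] by simp
    qed
  qed
qed

lemma central_limit_cdf:
  fixes f :: "'a \<Rightarrow> real"
  assumes [measurable]: "f \<in> borel_measurable M" and sq: "integrable M (\<lambda>x. (f x)\<^sup>2)"
    and mean: "expectation f = 0" and var: "expectation (\<lambda>x. (f x)\<^sup>2) = \<sigma>\<^sup>2" and \<sigma>: "0 < \<sigma>"
  shows "(\<lambda>n. measure (\<Pi>\<^sub>M j\<in>(UNIV::nat set). M)
           {\<omega> \<in> space (\<Pi>\<^sub>M j\<in>(UNIV::nat set). M). (\<Sum>i<n. f (\<omega> i)) \<le> t * \<sigma> * sqrt (real n)})
         \<longlonglongrightarrow> cdf std_normal_distribution t"
proof -
  let ?P = "\<Pi>\<^sub>M j\<in>(UNIV::nat set). M"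
  interpret P: prob_space ?P by (rule prob_space_sequences)
  interpret N: real_distribution std_normal_distribution by (rule real_dist_normal_dist)
  have "weak_conv_m (\<lambda>n. distr ?P borel (\<lambda>\<omega>. (\<Sum>i<n. f (\<omega> i)) / sqrt (real n * \<sigma>\<^sup>2))) std_normal_distribution"
  proof (rule P.central_limit_theorem_zero_mean[where \<mu> = "distr M borel f"])
    show "P.indep_vars (\<lambda>i. borel) (\<lambda>i \<omega>. f (\<omega> i)) UNIV" by (rule indep_vars_sequences) simp
    show "P.expectation (\<lambda>\<omega>. f (\<omega> n)) = 0" for n by (simp add: integral_component mean)
    then show "P.variance (\<lambda>\<omega>. f (\<omega> n)) = \<sigma>\<^sup>2" for n
      using integral_component[of "\<lambda>x. (f x)\<^sup>2" n] by (simp add: var)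
    show "integrable ?P (\<lambda>\<omega>. (f (\<omega> n))\<^sup>2)" for n
      using integrable_component_iff[of "\<lambda>x. (f x)\<^sup>2" n] sq by simp
    show "distr ?P borel (\<lambda>\<omega>. f (\<omega> n)) = distr M borel f" for n
      by (rule distr_component_sequences) simp
  qed fact
  \<comment> \<open>The normal law has no atoms, so weak convergence gives convergence of the
    distribution functions at every \<open>t\<close>.\<close>
  moreover have "isCont (cdf std_normal_distribution) t"
    unfolding N.isCont_cdf by (simp add: measure_def emeasure_density nn_integral_null_set)
  ultimately have "(\<lambda>n. cdf (distr ?P borel (\<lambda>\<omega>. (\<Sum>i<n. f (\<omega> i)) / sqrt (real n * \<sigma>\<^sup>2))) t)
      \<longlonglongrightarrow> cdf std_normal_distribution t"
    unfolding weak_conv_m_def weak_conv_def by blast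
  then show ?thesis
  proof (rule Lim_transform_eventually)
    show "\<forall>\<^sub>F n in sequentially. cdf (distr ?P borel (\<lambda>\<omega>. (\<Sum>i<n. f (\<omega> i)) / sqrt (real n * \<sigma>\<^sup>2))) t =
      measure ?P {\<omega> \<in> space ?P. (\<Sum>i<n. f (\<omega> i)) \<le> t * \<sigma> * sqrt (real n)}"
      using eventually_gt_at_top[of 0]
    proof eventually_elim
      case (elim n)
      have "cdf (distr ?P borel (\<lambda>\<omega>. (\<Sum>i<n. f (\<omega> i)) / sqrt (real n * \<sigma>\<^sup>2))) t =
        measure ?P ((\<lambda>\<omega>. (\<Sum>i<n. f (\<omega> i)) / sqrt (real n * \<sigma>\<^sup>2)) -` {..t} \<inter> space ?P)"
        unfolding cdf_def by (rule measure_distr) measurable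
      also have "(\<lambda>\<omega>. (\<Sum>i<n. f (\<omega> i)) / sqrt (real n * \<sigma>\<^sup>2)) -` {..t} \<inter> space ?P =
        {\<omega> \<in> space ?P. (\<Sum>i<n. f (\<omega> i)) \<le> t * \<sigma> * sqrt (real n)}"
        using elim \<sigma> by (auto simp: real_sqrt_mult field_simps)
      finally show ?case .
    qed
  qed
qed

end

section \<open>Gaussian tail and the Lambert function\<close>

text \<open>With \<open>\<phi>\<close> the normal density, \<open>- \<phi> x / (2 * x)\<close> has
  derivative \<open>\<phi> x * (1 / 2 + 1 / (2 * x\<^sup>2))\<close>, which is at most
  \<open>\<phi> x\<close> for \<open>x \<ge> 1\<close>. Integrating from \<open>t\<close> to
  infinity bounds the tail from below.\<close>

lemma cdf_std_normal_le:
  assumes t: "1 \<le> t"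
  shows "cdf std_normal_distribution t \<le> 1 - exp (- t\<^sup>2 / 2) / (2 * t * sqrt (2 * pi))"
proof -
  interpret N: real_distribution std_normal_distribution by (rule real_dist_normal_dist)
  define c where "c = 1 / sqrt (2 * pi)"
  have c: "0 < c" by (simp add: c_def)
  define F where "F x = - (c * exp (- x\<^sup>2 / 2) / (2 * x))" for x :: real
  define f where "f x = c * exp (- x\<^sup>2 / 2) * (1 / 2 + 1 / (2 * x\<^sup>2))" for x :: real
  have "(\<integral>\<^sup>+x. ennreal (f x) * indicator {t..} x \<partial>lborel) = ennreal (0 - F t)"
  proof (rule nn_integral_FTC_atLeast)
    show "f \<in> borel_measurable borel" unfolding f_def by measurable
    show "(F has_real_derivative f x) (at x)" if "t \<le> x" for x
      unfolding F_def f_def using that t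
      by (auto intro!: derivative_eq_intros simp: field_simps power2_eq_square)
    show "0 \<le> f x" for x using c by (simp add: f_def)
    show "(F \<longlongrightarrow> 0) at_top"
      unfolding F_def by real_asymp
  qed
  moreover have "(\<integral>\<^sup>+x. ennreal (f x) * indicator {t..} x \<partial>lborel) \<le> emeasure std_normal_distribution {t..}"
  proof -
    have "f x \<le> std_normal_density x" if "t \<le> x" for x
    proof -
      have "1 \<le> x\<^sup>2" using that t by (simp add: one_le_power)
      then have "1 / x\<^sup>2 \<le> 1" by (subst divide_le_eq_1) auto
      then have "1 / 2 + 1 / (2 * x\<^sup>2) \<le> 1" by simp
      then have "f x \<le> c * exp (- x\<^sup>2 / 2) * 1"
        unfolding f_def using c by (intro mult_left_mono) auto
      then show ?thesis by (simp add: std_normal_density_def c_def)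
    qed
    then show ?thesis
      by (subst emeasure_density)
        (auto intro!: nn_integral_mono ennreal_leI split: split_indicator)
  qed
  ultimately have "ennreal (- F t) \<le> ennreal (N.prob {t..})"
    by (simp add: N.emeasure_eq_measure)
  then have le: "- F t \<le> N.prob {t..}" by simp
  have "N.prob {t} = 0"
    by (simp add: measure_def emeasure_density nn_integral_null_set)
  moreover have "N.prob {t..} \<le> N.prob {t} + N.prob {t<..}"
    using measure_Un_le[of "{t}" std_normal_distribution "{t<..}"]
    unfolding ivl_disj_un_singleton by simp
  moreover have "N.prob {..t} + N.prob {t<..} = N.prob ({..t} \<union> {t<..})"
    by (intro N.finite_measure_Union[symmetric]) auto
  ultimately have "N.prob {..t} \<le> 1 - N.prob {t..}"
    using N.prob_le_1[of "{..t} \<union> {t<..}"] by linarith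
  with le show ?thesis
    by (simp add: cdf_def F_def c_def mult_ac)
qed

text \<open>A positive value of \<open>v * exp v\<close> forces \<open>v\<close> to be positive, and
  there the map is strictly increasing; this settles uniqueness in the definite description.\<close>

lemma lambert_W0_eqI:
  assumes "0 < w" "w * exp w = x"
  shows "lambert_W0 x = w"
  unfolding lambert_W0_def
proof (rule the_equality)
  fix v assume v: "- 1 \<le> v \<and> v * exp v = x"
  have "0 < x" using assms by auto
  then have "0 < v" using v by (metis exp_gt_zero zero_less_mult_pos2)
  show "v = w"
  proof (rule linorder_cases[of v w])
    assume "v < w"
    then have "v * exp v < w * exp w" using \<open>0 < v\<close> by (intro mult_strict_mono) auto
    then show ?thesis using v assms by simp
  next
    assume "w < v"
    then have "w * exp w < v * exp v" using \<open>0 < w\<close> by (intro mult_strict_mono) auto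
    then show ?thesis using v assms by simp
  qed
qed (use assms in auto)

text \<open>Intermediate values on \<open>[1, x]\<close>: the map \<open>w * exp w\<close> takes the
  value \<open>exp 1 < x\<close> at the left end and at least \<open>x\<close> at the right
  end.\<close>

lemma lambert_W0_gt_1:
  assumes "exp 1 < x"
  shows "1 < lambert_W0 x" "lambert_W0 x * exp (lambert_W0 x) = x"
proof -
  have "\<exists>w. 1 \<le> w \<and> w \<le> x \<and> w * exp w = x"
  proof (rule IVT')
    have "1 < exp (1::real)" by simp
    then have "1 < x" using assms by linarith
    then show "1 \<le> x" by simp
    show "x \<le> x * exp x" using \<open>1 < x\<close> by simp
  qed (use assms in \<open>auto intro!: continuous_intros\<close>)
  then obtain w where w: "1 \<le> w" "w * exp w = x" by blast
  then have "w \<noteq> 1" using assms by auto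
  moreover have "lambert_W0 x = w" using w by (intro lambert_W0_eqI) auto
  ultimately show "1 < lambert_W0 x" "lambert_W0 x * exp (lambert_W0 x) = x" using w by auto
qed

text \<open>Squaring the bound on \<open>\<delta>\<close> puts the argument of
  \<open>lambert_W0\<close> above \<open>exp 1\<close>. The second claim, squared, reads
  \<open>\<delta>\<^sup>2 = exp (- w) / (8 * pi * w)\<close>, which is the defining equation of
  \<open>w\<close> rearranged.\<close>

lemma lambert_W0_error_probability:
  assumes \<delta>: "0 < \<delta>" "\<delta> < 1 / sqrt (8 * pi * exp 1)"
  defines "w \<equiv> lambert_W0 (\<delta> powi (-2) / (8 * pi))"
  shows "1 < w" "exp (- (sqrt w)\<^sup>2 / 2) / (2 * sqrt w * sqrt (2 * pi)) = \<delta>"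
proof -
  have "\<delta>\<^sup>2 < (1 / sqrt (8 * pi * exp 1))\<^sup>2"
    using \<delta> by (intro power_strict_mono) auto
  also have "\<dots> = 1 / (8 * pi * exp 1)" by (simp add: power_divide)
  finally have "\<delta>\<^sup>2 * (8 * pi * exp 1) < 1" by (simp add: field_simps)
  then have x: "exp 1 < \<delta> powi (-2) / (8 * pi)"
    using \<delta> by (simp add: power_int_minus field_simps)
  show w: "1 < w" unfolding w_def by (rule lambert_W0_gt_1[OF x])
  have "w * exp w = \<delta> powi (-2) / (8 * pi)" unfolding w_def by (rule lambert_W0_gt_1[OF x])
  then have e: "\<delta>\<^sup>2 = exp (- w) / (8 * pi * w)"
    using \<delta> w by (simp add: power_int_minus field_simps exp_minus)
  have "(exp (- w / 2) / (2 * sqrt w * sqrt (2 * pi)))\<^sup>2 = exp (- w) / (8 * pi * w)"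
    using w by (simp add: power_divide power_mult_distrib flip: exp_double)
  with e have "(exp (- w / 2) / (2 * sqrt w * sqrt (2 * pi)))\<^sup>2 = \<delta>\<^sup>2" by simp
  then have "exp (- w / 2) / (2 * sqrt w * sqrt (2 * pi)) = \<delta>"
    using \<delta> w by (subst (asm) power2_eq_iff_nonneg) auto
  then show "exp (- (sqrt w)\<^sup>2 / 2) / (2 * sqrt w * sqrt (2 * pi)) = \<delta>"
    using w by simp
qed

section \<open>Partial derivatives\<close>

lemma has_derivative_partial_deriv:
  assumes "f differentiable (at y)"
  shows "(f has_derivative (\<lambda>h. \<Sum>i\<in>UNIV. h $ i * partial_deriv i f y)) (at y)"
proof -
  let ?D = "frechet_derivative f (at y)"
  have D: "(f has_derivative ?D) (at y)" using assms by (simp add: frechet_derivative_works)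
  then interpret linear ?D by (rule has_derivative_linear)
  have "?D h = (\<Sum>i\<in>UNIV. h $ i * partial_deriv i f y)" for h
  proof -
    have "?D h = ?D (\<Sum>i\<in>UNIV. h $ i *\<^sub>R axis i 1)"
      using basis_expansion[of h] by (simp add: scalar_mult_eq_scaleR)
    then show ?thesis by (simp add: sum scale partial_deriv_def)
  qed
  then have "?D = (\<lambda>h. \<Sum>i\<in>UNIV. h $ i * partial_deriv i f y)" by auto
  with D show ?thesis by simp
qed

lemma partial_deriv_unique:
  assumes "(f has_derivative D) (at y)"
  shows "partial_deriv i f y = D (axis i 1)"
  using frechet_derivative_at[OF assms] by (simp add: partial_deriv_def)

lemma partial_deriv_sum:
  assumes "\<And>m. m \<in> I \<Longrightarrow> f m differentiable (at y)"
  shows "partial_deriv i (\<lambda>z. \<Sum>m\<in>I. f m z) y = (\<Sum>m\<in>I. partial_deriv i (f m) y)"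
  unfolding partial_deriv_def[of i "f _"]
  by (rule partial_deriv_unique) (use assms in \<open>auto intro!: has_derivative_sum simp: frechet_derivative_works\<close>)

text \<open>The mean value theorem on the segment from \<open>x\<close> to \<open>y\<close>, with
  displacement and partial derivatives both bounded entrywise; summing over coordinates costs the
  factor \<open>CARD('d)\<close>.\<close>

lemma abs_diff_le_partial_derivs:
  fixes f :: "real^'d::finite \<Rightarrow> real"
  assumes S: "convex S" "x \<in> S" "y \<in> S"
    and D: "\<And>z. z \<in> S \<Longrightarrow> (f has_derivative (\<lambda>h. \<Sum>i\<in>UNIV. h $ i * D z i)) (at z)"
    and b: "\<And>z i. z \<in> S \<Longrightarrow> \<bar>D z i\<bar> \<le> b" and \<epsilon>: "\<And>i. \<bar>y $ i - x $ i\<bar> \<le> \<epsilon>"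
  shows "\<bar>f y - f x\<bar> \<le> real CARD('d) * \<epsilon> * b"
proof -
  let ?c = "\<lambda>s. x + s *\<^sub>R (y - x)"
  have seg: "?c s \<in> S" if "0 \<le> s" "s \<le> 1" for s
  proof -
    have "?c s = (1 - s) *\<^sub>R x + s *\<^sub>R y" by (simp add: algebra_simps)
    then show ?thesis using convexD_alt[OF S that] by simp
  qed
  have "\<exists>s\<in>{0..1}. (f \<circ> ?c) 1 - (f \<circ> ?c) 0 = (\<Sum>i\<in>UNIV. ((1 - 0) *\<^sub>R (y - x)) $ i * D (?c s) i)"
  proof (rule mvt_very_simple)
    fix s :: real assume s: "0 \<le> s" "s \<le> 1"
    have "(?c has_derivative (\<lambda>r. r *\<^sub>R (y - x))) (at s within {0..1})"
      by (auto intro!: derivative_eq_intros)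
    from diff_chain_within[OF this has_derivative_at_withinI[OF D[OF seg[OF s]]]]
    show "(f \<circ> ?c has_derivative (\<lambda>r. \<Sum>i\<in>UNIV. (r *\<^sub>R (y - x)) $ i * D (?c s) i)) (at s within {0..1})"
      by (simp add: comp_def)
  qed simp
  then obtain s where s: "s \<in> {0..1}" "f y - f x = (\<Sum>i\<in>UNIV. (y $ i - x $ i) * D (?c s) i)" by auto
  have "\<bar>f y - f x\<bar> \<le> (\<Sum>i\<in>UNIV. \<bar>(y $ i - x $ i) * D (?c s) i\<bar>)"
    unfolding s(2) by (rule sum_abs)
  also have "\<dots> \<le> (\<Sum>i\<in>(UNIV::'d set). \<epsilon> * b)"
    unfolding abs_mult
  proof (intro sum_mono mult_mono)
    show "0 \<le> \<epsilon>" using \<epsilon>[of undefined] by linarith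
  qed (use \<epsilon> b seg s in auto)
  finally show ?thesis by simp
qed

text \<open>The mean value bound is used twice: the remainder has partial derivatives
  \<open>partial_deriv i g z - partial_deriv i g x\<close>, and these are themselves bounded through
  the second derivatives.\<close>

lemma first_order_taylor_bound:
  fixes g :: "real^'d::finite \<Rightarrow> real"
  assumes S: "convex S" "x \<in> S" "y \<in> S" and T: "open T" "S \<subseteq> T" "Ck_on 2 g T"
    and \<epsilon>: "\<And>z i. z \<in> S \<Longrightarrow> \<bar>z $ i - x $ i\<bar> \<le> \<epsilon>"
    and b: "\<And>z i k. z \<in> S \<Longrightarrow> \<bar>partial_deriv k (partial_deriv i g) z\<bar> \<le> b"
  shows "\<bar>g y - g x - (\<Sum>i\<in>UNIV. (y $ i - x $ i) * partial_deriv i g x)\<bar> \<le> (real CARD('d))\<^sup>2 * \<epsilon>\<^sup>2 * b"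
proof -
  have C: "g differentiable (at z)" "partial_deriv i g differentiable (at z)" if "z \<in> S" for z i
  proof -
    have "z \<in> T" using T that by auto
    moreover have "g differentiable_on T" "partial_deriv i g differentiable_on T"
      using T(3) by (simp_all add: numeral_2_eq_2)
    ultimately show "g differentiable (at z)" "partial_deriv i g differentiable (at z)"
      by (simp_all add: differentiable_on_eq_differentiable_at[OF T(1)])
  qed
  let ?q = "\<lambda>z. g z - (\<Sum>i\<in>UNIV. (z $ i - x $ i) * partial_deriv i g x)"
  have "\<bar>?q y - ?q x\<bar> \<le> real CARD('d) * \<epsilon> * (real CARD('d) * \<epsilon> * b)"
  proof (rule abs_diff_le_partial_derivs[where f = ?q and
        D = "\<lambda>z i. partial_deriv i g z - partial_deriv i g x", OF S])
    fix z assume z: "z \<in> S"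
    have l: "((\<lambda>z. z $ i - x $ i) has_derivative (\<lambda>h. h $ i)) (at z)" for i
      using has_derivative_diff[OF bounded_linear_imp_has_derivative[OF bounded_linear_vec_nth[of i]]
          has_derivative_const[of "x $ i" "at z"]] by simp
    have "((\<lambda>z. \<Sum>i\<in>UNIV. (z $ i - x $ i) * partial_deriv i g x) has_derivative
        (\<lambda>h. \<Sum>i\<in>UNIV. h $ i * partial_deriv i g x)) (at z)"
      by (rule has_derivative_sum) (rule has_derivative_mult_left[OF l])
    from has_derivative_diff[OF has_derivative_partial_deriv[OF C(1)[OF z]] this]
    show "(?q has_derivative (\<lambda>h. \<Sum>i\<in>UNIV. h $ i * (partial_deriv i g z - partial_deriv i g x))) (at z)"
      by (simp add: right_diff_distrib sum_subtractf)
    show "\<bar>partial_deriv i g z - partial_deriv i g x\<bar> \<le> real CARD('d) * \<epsilon> * b" for i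
      by (rule abs_diff_le_partial_derivs[where f = "partial_deriv i g" and
            D = "\<lambda>z k. partial_deriv k (partial_deriv i g) z",
            OF S(1,2) z has_derivative_partial_deriv[OF C(2)] b \<epsilon>[OF z]])
  qed (rule \<epsilon>[OF S(3)])
  then show ?thesis by (simp add: power2_eq_square mult_ac)
qed

text \<open>A partial derivative is the pointwise limit of difference quotients along a fixed null
  sequence, so measurability in \<open>x\<close> passes from the densities to their
  derivatives.\<close>

lemma borel_measurable_partial_deriv:
  fixes F :: "'x \<Rightarrow> real^'d::finite \<Rightarrow> real"
  assumes "\<And>\<theta>. \<theta> \<in> T \<Longrightarrow> (\<lambda>x. F x \<theta>) \<in> borel_measurable M"
    and diff: "\<And>x. x \<in> space M \<Longrightarrow> F x differentiable (at \<theta>)" and T: "open T" "\<theta> \<in> T"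
  shows "(\<lambda>x. partial_deriv i (F x) \<theta>) \<in> borel_measurable M"
proof -
  let ?e = "axis i 1 :: real^'d"
  obtain r where r: "0 < r" "ball \<theta> r \<subseteq> T" using T open_contains_ball by blast
  \<comment> \<open>These increments are positive and stay below \<open>r\<close>, so every shifted
    point remains in \<open>T\<close>.\<close>
  define s where "s n = r / 2 / real (Suc n)" for n
  have s: "0 < s n" "s n < r" for n using r by (auto simp: s_def field_simps add_pos_nonneg)
  have "s \<longlonglongrightarrow> 0" unfolding s_def by (rule LIMSEQ_Suc[OF lim_const_over_n])
  then have s0: "filterlim s (at 0) sequentially"
    using s by (auto simp: filterlim_at intro!: always_eventually less_imp_neq[symmetric])
  have "\<theta> + s n *\<^sub>R ?e \<in> T" for n
    using s[of n] r by (auto simp: subset_iff dist_norm)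
  then have meas: "(\<lambda>x. F x (\<theta> + s n *\<^sub>R ?e)) \<in> borel_measurable M" "(\<lambda>x. F x \<theta>) \<in> borel_measurable M" for n
    using assms by auto
  show ?thesis
  proof (rule borel_measurable_LIMSEQ_real)
    show "(\<lambda>x. (F x (\<theta> + s n *\<^sub>R ?e) - F x \<theta>) / s n) \<in> borel_measurable M" for n
      using meas by measurable
    fix x assume x: "x \<in> space M"
    let ?c = "\<lambda>h. \<theta> + h *\<^sub>R ?e"
    have c: "(?c has_derivative (\<lambda>r. r *\<^sub>R ?e)) (at 0)"
      by (auto intro!: derivative_eq_intros)
    have "(F x has_derivative (\<lambda>h. \<Sum>j\<in>UNIV. h $ j * partial_deriv j (F x) \<theta>)) (at (?c 0))"
      using has_derivative_partial_deriv[OF diff[OF x]] by simp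
    from diff_chain_at[OF c this]
    have "(F x \<circ> ?c has_derivative (\<lambda>r. \<Sum>j\<in>UNIV. (r *\<^sub>R ?e) $ j * partial_deriv j (F x) \<theta>)) (at 0)"
      by (simp add: comp_def)
    also have "(\<lambda>r. \<Sum>j\<in>UNIV. (r *\<^sub>R ?e) $ j * partial_deriv j (F x) \<theta>) = (*) (partial_deriv i (F x) \<theta>)"
      by (auto simp: axis_def if_distrib if_distribR cong: if_cong)
    finally have "((\<lambda>h. ((F x \<circ> ?c) (0 + h) - (F x \<circ> ?c) 0) / h) \<longlongrightarrow> partial_deriv i (F x) \<theta>) (at 0)"
      unfolding has_field_derivative_def[symmetric] DERIV_def .
    from filterlim_compose[OF this s0]
    show "(\<lambda>n. (F x (\<theta> + s n *\<^sub>R ?e) - F x \<theta>) / s n) \<longlonglongrightarrow> partial_deriv i (F x) \<theta>"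
      by simp
  qed
qed

lemma sum_mult_axis: "(\<Sum>k\<in>UNIV. g k * axis c 1 $ k) = (g c :: real)"
  by (simp add: axis_def mult_delta_right)

text \<open>The trilinear form at three basis vectors is an entry. A supremum of reals dominates its
  members only when bounded above, and the sum of all absolute entries is such a bound.\<close>

lemma abs_entry_le_tensor3_onorm:
  fixes T :: "real^'d^'d^'d::finite"
  shows "\<bar>T $ a $ b $ c\<bar> \<le> tensor3_onorm T"
proof -
  let ?f = "\<lambda>(u, v, w). \<bar>\<Sum>i\<in>UNIV. \<Sum>j\<in>UNIV. \<Sum>k\<in>UNIV. T $ i $ j $ k * u $ i * v $ j * w $ k\<bar>"
  have entry: "\<bar>u $ i\<bar> \<le> 1" if "u \<in> sphere 0 1" for u :: "real^'d" and i
    using component_le_norm_cart[of u i] that by simp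
  have "?f t \<le> (\<Sum>i\<in>UNIV. \<Sum>j\<in>UNIV. \<Sum>k\<in>UNIV. \<bar>T $ i $ j $ k\<bar>)"
    if "t \<in> sphere 0 1 \<times> sphere 0 1 \<times> sphere 0 1" for t
  proof -
    obtain u v w where t: "t = (u, v, w)" by (metis prod_cases3)
    have "\<bar>T $ i $ j $ k * u $ i * v $ j * w $ k\<bar> \<le> \<bar>T $ i $ j $ k\<bar> * 1 * 1 * 1" for i j k
      unfolding abs_mult using that entry unfolding t by (intro mult_mono) auto
    then show ?thesis
      unfolding t prod.case by (intro sum_abs[THEN order_trans] sum_mono) simp
  qed
  then have bdd: "bdd_above (?f ` (sphere 0 1 \<times> sphere 0 1 \<times> sphere 0 1))"
    by (intro bdd_aboveI2) blast
  have "\<bar>T $ a $ b $ c\<bar> = ?f (axis a 1, axis b 1, axis c 1)"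
    by (simp only: sum_mult_axis prod.case)
  also have "\<dots> \<le> tensor3_onorm T"
    unfolding tensor3_onorm_def by (rule cSUP_upper[OF _ bdd]) (auto simp: norm_axis_1)
  finally show ?thesis .
qed

text \<open>If the value at \<open>y\<close> exceeded the supremum, so would the values on a
  nonempty open set, and that set meets \<open>D\<close>. In \<open>ennreal\<close> the supremum
  always exists.\<close>

lemma le_SUP_dense:
  fixes g :: "'a::topological_space \<Rightarrow> real"
  assumes U: "open U" "continuous_on U g" "y \<in> U"
    and D: "\<And>V. open V \<Longrightarrow> V \<noteq> {} \<Longrightarrow> \<exists>d\<in>D. d \<in> V"
  shows "ennreal \<bar>g y\<bar> \<le> (SUP z\<in>D \<inter> U. ennreal \<bar>g z\<bar>)" (is "_ \<le> ?s")
proof (rule ccontr)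
  assume "\<not> ?thesis"
  then have y: "?s < ennreal \<bar>g y\<bar>" by simp
  have "open (U \<inter> (\<lambda>z. ennreal \<bar>g z\<bar>) -` {?s<..})"
    using U by (intro continuous_open_preimage continuous_on_ennreal continuous_intros) auto
  moreover have "U \<inter> (\<lambda>z. ennreal \<bar>g z\<bar>) -` {?s<..} \<noteq> {}" using y U by blast
  ultimately obtain d where "d \<in> D" "d \<in> U" "?s < ennreal \<bar>g d\<bar>" using D by blast
  then show False by (metis IntI SUP_upper leD)
qed

section \<open>The lower bound\<close>

text \<open>A liminf is at least 1 once every threshold below 1 is eventually exceeded. Raising the
  threshold to a positive real \<open>c\<close> also covers negative and infinite
  thresholds.\<close>

lemma asymp_geI:
  assumes pos: "\<forall>\<^sub>F \<epsilon> in at_right 0. 0 < B \<epsilon>"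
    and le: "\<And>c. 0 < c \<Longrightarrow> c < 1 \<Longrightarrow> \<forall>\<^sub>F \<epsilon> in at_right 0. ereal (c * B \<epsilon>) \<le> A \<epsilon>"
  shows "asymp_ge A B"
  unfolding asymp_ge_def le_Liminf_iff
proof (intro allI impI)
  fix y :: ereal assume "y < 1"
  then have "max y 0 < 1" by simp
  then obtain c where "max y 0 < ereal c" "ereal c < 1" using ereal_dense2 by blast
  then have c: "y < ereal c" "0 < c" "c < 1" by auto
  show "\<forall>\<^sub>F \<epsilon> in at_right 0. y < A \<epsilon> / ereal (B \<epsilon>)"
    using pos le[OF c(2,3)]
  proof eventually_elim
    case (elim \<epsilon>)
    then have "ereal c \<le> A \<epsilon> / ereal (B \<epsilon>)"
      by (subst ereal_le_divide_pos) (auto simp: mult.commute)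
    with c(1) show ?case by (rule less_le_trans)
  qed
qed

text \<open>The guarantee must hold from the threshold onwards, so a single failure at
  \<open>M\<close> rules out every threshold up to \<open>M\<close>.\<close>

lemma min_reps_ge:
  assumes "\<not> mle_guarantee \<nu> p \<Theta> \<delta> \<epsilon> M"
  shows "enat M \<le> min_reps \<nu> p \<Theta> \<delta> \<epsilon>"
  unfolding min_reps_def
proof (rule Inf_greatest)
  fix e assume "e \<in> enat ` {M\<^sub>0. 1 \<le> M\<^sub>0 \<and> (\<forall>M\<ge>M\<^sub>0. mle_guarantee \<nu> p \<Theta> \<delta> \<epsilon> M)}"
  then obtain M\<^sub>0 where "e = enat M\<^sub>0" "\<forall>M\<ge>M\<^sub>0. mle_guarantee \<nu> p \<Theta> \<delta> \<epsilon> M" by auto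
  then show "enat M \<le> e" using assms by (cases "M\<^sub>0 \<le> M") auto
qed

section \<open>Smoothness, measurability and the likelihood equation\<close>

context regular_model
begin

lemma space_law [simp]: "space (law \<nu> p \<theta>) = space \<nu>"
  and sets_law [simp, measurable_cong]: "sets (law \<nu> p \<theta>) = sets \<nu>"
  by (simp_all add: law_def)

text \<open>\<open>A2\<close> concerns samples; a sample of size one turns it into a statement about
  a single outcome.\<close>

lemma Ck_loglik1:
  assumes "x \<in> space \<nu>"
  shows "Ck_on 3 (loglik1 p x) \<Theta>'"
proof -
  have "(\<lambda>i\<in>{..<1}. x) \<in> samples \<nu> 1"
    using assms by (auto simp: samples_def space_PiM)
  from A2[OF order_refl this] show ?thesis
    by (simp add: loglik_def[abs_def])
qed

lemma derivs_differentiable: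
  assumes x: "x \<in> space \<nu>" and y: "y \<in> \<Theta>'"
  shows "loglik1 p x differentiable (at y)"
    and "partial_deriv i (loglik1 p x) differentiable (at y)"
    and "partial_deriv i (partial_deriv j (loglik1 p x)) differentiable (at y)"
    and "Ck_on 2 (partial_deriv i (loglik1 p x)) \<Theta>'"
    and "continuous_on \<Theta>' (partial_deriv i (partial_deriv j (partial_deriv k (loglik1 p x))))"
  using Ck_loglik1[OF x] y R1(1)
  by (auto simp: numeral_3_eq_3 numeral_2_eq_2 differentiable_on_eq_differentiable_at)

lemma third_deriv_measurable:
  assumes "y \<in> \<Theta>'"
  shows "(\<lambda>x. partial_deriv i (partial_deriv j (partial_deriv k (loglik1 p x))) y) \<in> borel_measurable \<nu>"
proof -
  have 0: "(\<lambda>x. loglik1 p x y) \<in> borel_measurable \<nu>" if "y \<in> \<Theta>'" for y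
    using density_measurable[OF that] unfolding loglik1_def by measurable
  have 1: "(\<lambda>x. partial_deriv k (loglik1 p x) y) \<in> borel_measurable \<nu>" if "y \<in> \<Theta>'" for y k
    by (rule borel_measurable_partial_deriv[OF 0 derivs_differentiable(1) R1(1)]) (use that in auto)
  have 2: "(\<lambda>x. partial_deriv j (partial_deriv k (loglik1 p x)) y) \<in> borel_measurable \<nu>" if "y \<in> \<Theta>'" for y j k
    by (rule borel_measurable_partial_deriv[OF 1 derivs_differentiable(2) R1(1)]) (use that in auto)
  show ?thesis
    by (rule borel_measurable_partial_deriv[OF 2 derivs_differentiable(3) R1(1)]) (use assms in auto)
qed

text \<open>The supremum in \<open>R4\<close> need not be measurable a priori, so it is replaced by one over a countable
  dense set of parameters.\<close>

lemma third_deriv_envelope: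
  assumes \<theta>: "\<theta> \<in> \<Theta>"
  obtains B where "B \<in> borel_measurable \<nu>" "(\<integral>\<^sup>+x. B x \<partial>law \<nu> p \<theta>) < \<infinity>"
    "\<And>x y i j k. x \<in> space \<nu> \<Longrightarrow> y \<in> ball \<theta> r\<^sub>0 \<Longrightarrow>
       ennreal \<bar>partial_deriv i (partial_deriv j (partial_deriv k (loglik1 p x))) y\<bar> \<le> B x"
proof -
  let ?t = "\<lambda>x y i j k. ennreal \<bar>partial_deriv i (partial_deriv j (partial_deriv k (loglik1 p x))) y\<bar>"
  obtain D :: "(real^'d) set" where D: "countable D" "\<And>V. open V \<Longrightarrow> V \<noteq> {} \<Longrightarrow> \<exists>d\<in>D. d \<in> V"
    using countable_dense_setE by blast
  \<comment> \<open>The open ball, so that the density argument of \<open>le_SUP_dense\<close>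
    applies.\<close>
  define U where "U = ball \<theta> r\<^sub>0"
  have U: "open U" "U \<subseteq> \<Theta>'"
  proof -
    show "U \<subseteq> \<Theta>'"
    proof
      fix y assume "y \<in> U"
      then show "y \<in> \<Theta>'" using R1(4)[OF \<theta>, of "y - \<theta>"] by (simp add: U_def dist_norm norm_minus_commute)
    qed
  qed (simp add: U_def)
  define I where "I = (D \<inter> U) \<times> (UNIV :: ('d \<times> 'd \<times> 'd) set)"
  define B where "B x = (SUP (y, i, j, k)\<in>I. ?t x y i j k)" for x
  define R where "R x = (SUP \<Delta>\<in>cball 0 r\<^sub>0. ennreal (tensor3_onorm (third_derivs (loglik1 p x) (\<theta> + \<Delta>))))" for x
  have "countable I" unfolding I_def using D(1) by (intro countable_SIGMA) auto
  have B: "B \<in> borel_measurable \<nu>"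
    unfolding B_def
  proof (rule borel_measurable_SUP[OF \<open>countable I\<close>])
    fix t assume "t \<in> I"
    then obtain y i j k where "t = (y, i, j, k)" "y \<in> \<Theta>'" using U by (auto simp: I_def)
    then show "(\<lambda>x. case t of (y, i, j, k) \<Rightarrow> ?t x y i j k) \<in> borel_measurable \<nu>"
      using third_deriv_measurable[of y i j k] by simp
  qed
  interpret prob_space "law \<nu> p \<theta>" by (rule prob[OF \<theta>])
  have BR: "B x \<le> R x" for x
    unfolding B_def
  proof (rule SUP_least, clarify)
    fix y i j k assume "(y, i, j, k) \<in> I"
    then have y: "y - \<theta> \<in> cball 0 r\<^sub>0" by (auto simp: I_def U_def dist_norm norm_minus_commute)
    have "?t x y i j k \<le> ennreal (tensor3_onorm (third_derivs (loglik1 p x) (\<theta> + (y - \<theta>))))"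
      using abs_entry_le_tensor3_onorm[of "third_derivs (loglik1 p x) y" i j k]
      by (simp add: third_derivs_def ennreal_leI)
    also have "\<dots> \<le> R x" unfolding R_def by (rule SUP_upper[OF y])
    finally show "?t x y i j k \<le> R x" .
  qed
  \<comment> \<open>\<open>R4\<close> bounds a second moment while Markov's inequality needs a
    first; under a probability law the constant contributes only 1.\<close>
  have le: "b \<le> 1 + b\<^sup>2" for b :: ennreal
  proof (cases "b \<le> 1")
    case True then show ?thesis by (simp add: add_increasing2)
  next
    case False
    then have "b * 1 \<le> b * b" by (intro mult_left_mono) auto
    then show ?thesis by (simp add: power2_eq_square add_increasing)
  qed
  have "(\<integral>\<^sup>+x. B x \<partial>law \<nu> p \<theta>) \<le> (\<integral>\<^sup>+x. 1 + (B x)\<^sup>2 \<partial>law \<nu> p \<theta>)"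
    by (intro nn_integral_mono le)
  also have "\<dots> = 1 + (\<integral>\<^sup>+x. (B x)\<^sup>2 \<partial>law \<nu> p \<theta>)"
    using B by (subst nn_integral_add) (auto simp: emeasure_space_1[simplified])
  \<comment> \<open>Monotonicity of \<open>nn_integral\<close> asks for no measurability, so
    \<open>R\<close> may appear here.\<close>
  also have "(\<integral>\<^sup>+x. (B x)\<^sup>2 \<partial>law \<nu> p \<theta>) \<le> (\<integral>\<^sup>+x. (R x)\<^sup>2 \<partial>law \<nu> p \<theta>)"
    by (intro nn_integral_mono power_mono BR) auto
  also have "\<dots> \<le> (SUP \<theta>\<in>\<Theta>. \<integral>\<^sup>+x. (SUP \<Delta>\<in>cball 0 r\<^sub>0.
      ennreal (tensor3_onorm (third_derivs (loglik1 p x) (\<theta> + \<Delta>))))\<^sup>2 \<partial>law \<nu> p \<theta>)"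
    unfolding R_def by (rule SUP_upper[OF \<theta>])
  also have "1 + \<dots> < \<infinity>" using R4 by (simp add: ennreal_add_less_top)
  finally have fin: "(\<integral>\<^sup>+x. B x \<partial>law \<nu> p \<theta>) < \<infinity>" by simp
  have "?t x y i j k \<le> B x" if "x \<in> space \<nu>" "y \<in> ball \<theta> r\<^sub>0" for x y i j k
  proof -
    have "continuous_on U (partial_deriv i (partial_deriv j (partial_deriv k (loglik1 p x))))"
      using derivs_differentiable(5)[OF that(1)] U R1(2) \<theta> by (blast intro: continuous_on_subset)
    then have "?t x y i j k \<le> (SUP z\<in>D \<inter> U. ?t x z i j k)"
      using that(2) D(2) by (intro le_SUP_dense[OF U(1)]) (auto simp: U_def)
    also have "\<dots> \<le> B x"
      unfolding B_def by (rule SUP_least) (rule SUP_upper2[of "(_, i, j, k)"], auto simp: I_def)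
    finally show ?thesis .
  qed
  with B fin show thesis by (rule that)
qed

text \<open>\<open>arg_max\<close> is a choice among maximizers; uniqueness in \<open>A1\<close>
  identifies it with the point that is also stationary.\<close>

lemma mle_stationary:
  assumes "1 \<le> M" "xs \<in> samples \<nu> M"
  shows "mle p \<Theta> M xs \<in> \<Theta>" "(\<Sum>m<M. partial_deriv j (loglik1 p (xs m)) (mle p \<Theta> M xs)) = 0"
proof -
  obtain t where t: "t \<in> interior \<Theta>"
    "{\<theta>. is_arg_max (loglik p M xs) (\<lambda>\<theta>. \<theta> \<in> \<Theta>) \<theta>} = {t}"
    "{\<theta> \<in> \<Theta>. gradient (loglik p M xs) \<theta> = 0} = {t}"
    using A1[OF assms] by blast
  have "is_arg_max (loglik p M xs) (\<lambda>\<theta>. \<theta> \<in> \<Theta>) t" using t(2) by auto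
  then have "is_arg_max (loglik p M xs) (\<lambda>\<theta>. \<theta> \<in> \<Theta>) (mle p \<Theta> M xs)"
    unfolding mle_def arg_max_def by (rule someI)
  then have mle: "mle p \<Theta> M xs = t" using t(2) by auto
  then show mem: "mle p \<Theta> M xs \<in> \<Theta>" using t(1) interior_subset by auto
  have "gradient (loglik p M xs) t = 0" using t(3) by blast
  then have "partial_deriv j (loglik p M xs) t = 0"
    by (simp add: gradient_def vec_eq_iff)
  moreover have "partial_deriv j (loglik p M xs) t = (\<Sum>m<M. partial_deriv j (loglik1 p (xs m)) t)"
    unfolding loglik_def[abs_def]
  proof (rule partial_deriv_sum)
    fix m assume "m \<in> {..<M}"
    then have "xs m \<in> space \<nu>" using assms(2) by (auto simp: samples_def space_PiM)
    then show "loglik1 p (xs m) differentiable (at t)"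
      using mem mle R1(2) by (intro derivs_differentiable(1)) auto
  qed
  ultimately show "(\<Sum>m<M. partial_deriv j (loglik1 p (xs m)) (mle p \<Theta> M xs)) = 0"
    by (simp add: mle)
qed

section \<open>Moments of the score and the inverse Fisher matrix\<close>

abbreviation score :: "real^'d \<Rightarrow> 'x \<Rightarrow> real^'d" where
  "score \<theta> x \<equiv> gradient (loglik1 p x) \<theta>"

context
  fixes \<theta> assumes \<theta>: "\<theta> \<in> \<Theta>"
begin

lemma score_entry_measurable [measurable]: "(\<lambda>x. score \<theta> x $ i) \<in> borel_measurable (law \<nu> p \<theta>)"
  using score_integrable[OF \<theta>]
  by (intro borel_measurable_integrable integrable_bounded_linear[OF bounded_linear_vec_nth])

lemma integrable_score_product: "integrable (law \<nu> p \<theta>) (\<lambda>x. score \<theta> x $ i * score \<theta> x $ j)"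
proof (rule Bochner_Integration.integrable_bound[OF score_sq_integrable[OF \<theta>]])
  show "(\<lambda>x. score \<theta> x $ i * score \<theta> x $ j) \<in> borel_measurable (law \<nu> p \<theta>)" by measurable
  have "norm (v $ i * v $ j) \<le> norm ((norm v)\<^sup>2)" for v :: "real^'d"
    unfolding real_norm_def abs_mult power2_eq_square
    by (intro mult_mono) (auto intro: component_le_norm_cart)
  then show "AE x in law \<nu> p \<theta>. norm (score \<theta> x $ i * score \<theta> x $ j) \<le> norm ((norm (score \<theta> x))\<^sup>2)"
    by simp
qed

lemma fisher_entry: "fisher \<nu> p \<theta> $ i $ j = (\<integral>x. score \<theta> x $ i * score \<theta> x $ j \<partial>law \<nu> p \<theta>)"
  by (simp add: fisher_def)

text \<open>Mixed moments of one score entry with a direction give both the variance in that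
  direction and the positivity of the diagonal of the inverse Fisher matrix.\<close>

lemma score_direction_product:
  shows "integrable (law \<nu> p \<theta>) (\<lambda>x. score \<theta> x $ i * (u \<bullet> score \<theta> x))"
    and "(\<integral>x. score \<theta> x $ i * (u \<bullet> score \<theta> x) \<partial>law \<nu> p \<theta>) = (fisher \<nu> p \<theta> *v u) $ i"
proof -
  have eq: "score \<theta> x $ i * (u \<bullet> score \<theta> x) = (\<Sum>j\<in>UNIV. u $ j * (score \<theta> x $ i * score \<theta> x $ j))" for x
    by (simp add: inner_vec_def sum_distrib_left mult_ac)
  show "integrable (law \<nu> p \<theta>) (\<lambda>x. score \<theta> x $ i * (u \<bullet> score \<theta> x))"
    unfolding eq using integrable_score_product by simp
  show "(\<integral>x. score \<theta> x $ i * (u \<bullet> score \<theta> x) \<partial>law \<nu> p \<theta>) = (fisher \<nu> p \<theta> *v u) $ i"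
    unfolding eq by (subst Bochner_Integration.integral_sum)
      (simp_all add: integrable_score_product matrix_vector_mult_def fisher_entry mult.commute)
qed

lemma score_direction:
  shows "(\<lambda>x. u \<bullet> score \<theta> x) \<in> borel_measurable (law \<nu> p \<theta>)"
    and "(\<integral>x. u \<bullet> score \<theta> x \<partial>law \<nu> p \<theta>) = 0"
    and "integrable (law \<nu> p \<theta>) (\<lambda>x. (u \<bullet> score \<theta> x)\<^sup>2)"
    and "(\<integral>x. (u \<bullet> score \<theta> x)\<^sup>2 \<partial>law \<nu> p \<theta>) = u \<bullet> (fisher \<nu> p \<theta> *v u)"
proof -
  show "(\<lambda>x. u \<bullet> score \<theta> x) \<in> borel_measurable (law \<nu> p \<theta>)"
    unfolding inner_vec_def by measurable
  show "(\<integral>x. u \<bullet> score \<theta> x \<partial>law \<nu> p \<theta>) = 0"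
    using score_integrable[OF \<theta>] score_mean[OF \<theta>] by simp
  have eq: "(u \<bullet> score \<theta> x)\<^sup>2 = (\<Sum>i\<in>UNIV. u $ i * (score \<theta> x $ i * (u \<bullet> score \<theta> x)))" for x
  proof -
    have "z * (\<Sum>i\<in>UNIV. u $ i * score \<theta> x $ i) = (\<Sum>i\<in>UNIV. u $ i * (score \<theta> x $ i * z))" for z
      by (simp add: sum_distrib_left mult_ac)
    from this[of "u \<bullet> score \<theta> x"] show ?thesis
      by (simp add: power2_eq_square inner_vec_def)
  qed
  show "integrable (law \<nu> p \<theta>) (\<lambda>x. (u \<bullet> score \<theta> x)\<^sup>2)"
    unfolding eq using score_direction_product(1) by simp
  show "(\<integral>x. (u \<bullet> score \<theta> x)\<^sup>2 \<partial>law \<nu> p \<theta>) = u \<bullet> (fisher \<nu> p \<theta> *v u)"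
    unfolding eq by (subst Bochner_Integration.integral_sum)
      (simp_all add: score_direction_product inner_vec_def[of u "fisher \<nu> p \<theta> *v u"])
qed

lemma hessian_entry:
  shows "integrable (law \<nu> p \<theta>) (\<lambda>x. partial_deriv i (partial_deriv j (loglik1 p x)) \<theta>)"
    and "(\<integral>x. partial_deriv i (partial_deriv j (loglik1 p x)) \<theta> \<partial>law \<nu> p \<theta>) = - fisher \<nu> p \<theta> $ i $ j"
proof -
  have bl: "bounded_linear (\<lambda>A :: real^'d^'d. A $ i $ j)"
    using bounded_linear_compose[OF bounded_linear_vec_nth bounded_linear_vec_nth] .
  have eq: "partial_deriv i (partial_deriv j (loglik1 p x)) \<theta> = hessian (loglik1 p x) \<theta> $ i $ j" for x
    by (simp add: hessian_def)
  show "integrable (law \<nu> p \<theta>) (\<lambda>x. partial_deriv i (partial_deriv j (loglik1 p x)) \<theta>)"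
    unfolding eq by (rule integrable_bounded_linear[OF bl hessian_integrable[OF \<theta>]])
  show "(\<integral>x. partial_deriv i (partial_deriv j (loglik1 p x)) \<theta> \<partial>law \<nu> p \<theta>) = - fisher \<nu> p \<theta> $ i $ j"
    unfolding eq integral_bounded_linear[OF bl hessian_integrable[OF \<theta>]] hessian_mean[OF \<theta>] by simp
qed

lemma fisher_inv_column:
  defines "u a \<equiv> fisher_inv \<nu> p \<theta> *v axis a 1"
  shows "fisher \<nu> p \<theta> *v u a = axis a 1"
    and "u a \<bullet> (fisher \<nu> p \<theta> *v u a) = fisher_inv \<nu> p \<theta> $ a $ a"
proof -
  show F: "fisher \<nu> p \<theta> *v u a = axis a 1"
    unfolding u_def matrix_vector_mul_assoc
    using someI_ex[OF R2(1)[OF \<theta>, unfolded invertible_def]] by (simp add: matrix_inv_def)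
  show "u a \<bullet> (fisher \<nu> p \<theta> *v u a) = fisher_inv \<nu> p \<theta> $ a $ a"
    unfolding F by (simp add: u_def inner_axis matrix_vector_mult_basis column_def)
qed

text \<open>The entry is the second moment of \<open>u \<bullet> score\<close>. Were it zero,
  \<open>u \<bullet> score\<close> would vanish almost surely, and the mixed moment
  \<open>(F u)\<^sub>a\<close> would be 0 instead of 1.\<close>

lemma fisher_inv_diagonal_pos: "0 < fisher_inv \<nu> p \<theta> $ a $ a"
proof -
  define u where "u = fisher_inv \<nu> p \<theta> *v axis a 1"
  let ?v = "fisher_inv \<nu> p \<theta> $ a $ a"
  have v: "?v = (\<integral>x. (u \<bullet> score \<theta> x)\<^sup>2 \<partial>law \<nu> p \<theta>)"
    unfolding score_direction(4) u_def fisher_inv_column(2) ..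
  have "?v \<noteq> 0"
  proof
    assume "?v = 0"
    then have "AE x in law \<nu> p \<theta>. (u \<bullet> score \<theta> x)\<^sup>2 = 0"
      using integral_nonneg_eq_0_iff_AE[OF score_direction(3)[of u]] v by simp
    then have "(\<integral>x. score \<theta> x $ a * (u \<bullet> score \<theta> x) \<partial>law \<nu> p \<theta>) = (\<integral>x. 0 \<partial>law \<nu> p \<theta>)"
      by (intro integral_cong_AE borel_measurable_times score_entry_measurable score_direction(1)) auto
    then show False
      unfolding score_direction_product(2) u_def fisher_inv_column(1) by (simp add: axis_def)
  qed
  moreover have "0 \<le> ?v" unfolding v by simp
  ultimately show ?thesis by simp
qed

end

text \<open>Makes the real-valued \<open>SUP\<close> of the theorem a genuine supremum: diagonal
  entries are bounded by the operator norm, hence by \<open>R2\<close>.\<close>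

lemma bdd_above_fisher_inv_diagonal:
  "bdd_above ((\<lambda>\<theta>. MAX a. fisher_inv \<nu> p \<theta> $ a $ a) ` \<Theta>)"
proof -
  obtain K where K: "\<And>\<theta>. \<theta> \<in> \<Theta> \<Longrightarrow> onorm (\<lambda>v. fisher_inv \<nu> p \<theta> *v v) \<le> K"
    using R2(2) by (auto simp: bdd_above_def)
  have "A $ a $ a \<le> onorm (\<lambda>v. A *v v)" for A :: "real^'d^'d" and a
  proof -
    have "A $ a $ a = (A *v axis a 1) $ a" by (simp add: matrix_vector_mult_basis column_def)
    also have "\<dots> \<le> norm (A *v axis a 1)" using component_le_norm_cart[of "A *v axis a 1" a] by simp
    also have "\<dots> \<le> onorm (\<lambda>v. A *v v) * norm (axis a 1 :: real^'d)"
      by (rule onorm) (rule matrix_vector_mul_bounded_linear)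
    finally show ?thesis by (simp add: norm_axis_1)
  qed
  then have "(MAX a. fisher_inv \<nu> p \<theta> $ a $ a) \<le> K" if "\<theta> \<in> \<Theta>" for \<theta>
    using K[OF that] by (auto intro: order_trans)
  then show ?thesis by (rule bdd_aboveI2)
qed

section \<open>Expansion of the likelihood equation\<close>

text \<open>If the estimator is accurate to within \<open>\<epsilon>\<close>, expanding the likelihood equation around \<open>\<theta>\<close> shows
  that the normalised score in the direction \<open>u\<close> with \<open>F u = e\<^sub>a\<close> is essentially the \<open>a\<close>-th
  component of the error.\<close>

lemma score_expansion:
  assumes \<theta>: "\<theta> \<in> \<Theta>" and M: "1 \<le> M" and xs: "xs \<in> samples \<nu> M"
    and acc: "infnorm (mle p \<Theta> M xs - \<theta>) \<le> \<epsilon>"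
    and \<epsilon>: "0 < \<epsilon>" "real CARD('d) * \<epsilon> < r\<^sub>0"
    and B: "\<And>x y i j k. x \<in> space \<nu> \<Longrightarrow> y \<in> ball \<theta> r\<^sub>0 \<Longrightarrow>
       ennreal \<bar>partial_deriv i (partial_deriv j (partial_deriv k (loglik1 p x))) y\<bar> \<le> B x"
    and sumB: "(\<Sum>m<M. B (xs m)) < ennreal (real M * (\<eta> / (real CARD('d) * \<epsilon>)))"
    and hess: "\<And>i j. \<bar>(\<Sum>m<M. partial_deriv i (partial_deriv j (loglik1 p (xs m))) \<theta>)
        + real M * fisher \<nu> p \<theta> $ i $ j\<bar> < real M * \<eta>"
    and \<eta>: "0 < \<eta>" and u: "fisher \<nu> p \<theta> *v u = axis a 1"
  shows "\<bar>\<Sum>m<M. u \<bullet> score \<theta> (xs m)\<bar> \<le> real M * \<epsilon> * (1 + 2 * real CARD('d) * (\<Sum>j\<in>UNIV. \<bar>u $ j\<bar>) * \<eta>)"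
proof -
  define t where "t = mle p \<Theta> M xs"
  define d where "d = real CARD('d)"
  have d: "1 \<le> d" by (simp add: d_def Suc_leI)
  define v where "v = t - \<theta>"
  have v: "\<bar>v $ i\<bar> \<le> \<epsilon>" for i
    using component_le_infnorm_cart[of v i] acc by (simp add: v_def t_def)
  \<comment> \<open>The box for the maximum norm is convex and contains the estimator; since the
    Euclidean norm is at most the sum of the entries, it lies in the ball where \<open>B\<close>
    dominates.\<close>
  define S where "S = {y. \<forall>i. \<bar>y $ i - \<theta> $ i\<bar> \<le> \<epsilon>}"
  have "S = cbox (\<theta> - (\<chi> i. \<epsilon>)) (\<theta> + (\<chi> i. \<epsilon>))"
    by (auto simp: S_def mem_box_cart abs_le_iff algebra_simps)
  then have S: "convex S" "\<theta> \<in> S" "t \<in> S"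
    using \<epsilon> v by (auto simp: v_def) (auto simp: S_def)
  have Sball: "S \<subseteq> ball \<theta> r\<^sub>0"
  proof
    fix y assume "y \<in> S"
    then have "norm (y - \<theta>) \<le> (\<Sum>i\<in>(UNIV::'d set). \<epsilon>)"
      by (intro norm_le_l1_cart[THEN order_trans] sum_mono) (simp add: S_def)
    then show "y \<in> ball \<theta> r\<^sub>0" using \<epsilon> by (simp add: dist_norm norm_minus_commute)
  qed
  have ball: "ball \<theta> r\<^sub>0 \<subseteq> \<Theta>'"
  proof
    fix y assume "y \<in> ball \<theta> r\<^sub>0"
    then show "y \<in> \<Theta>'" using R1(4)[OF \<theta>, of "y - \<theta>"] by (simp add: dist_norm norm_minus_commute)
  qed
  have x: "xs m \<in> space \<nu>" if "m < M" for m
    using xs that by (auto simp: samples_def space_PiM)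
  define b where "b m = enn2real (B (xs m))" for m
  have "B (xs m) < \<top>" if "m < M" for m
  proof -
    have "B (xs m) \<le> (\<Sum>m<M. B (xs m))" using that by (intro member_le_sum) auto
    also have "\<dots> < \<top>" using sumB by (rule order.strict_trans) simp
    finally show ?thesis .
  qed
  then have b: "B (xs m) = ennreal (b m)" if "m < M" for m using that by (simp add: b_def)
  have b0: "0 \<le> b m" for m by (simp add: b_def)
  have "ennreal (\<Sum>m<M. b m) < ennreal (real M * (\<eta> / (d * \<epsilon>)))"
    using sumB b0 by (simp add: b d_def flip: sum_ennreal)
  then have sumb: "(\<Sum>m<M. b m) \<le> real M * (\<eta> / (d * \<epsilon>))"
    using b0 by (subst (asm) ennreal_less_iff) (auto intro: sum_nonneg)

  define s where "s j = (\<Sum>m<M. partial_deriv j (loglik1 p (xs m)) \<theta>)" for j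
  define Hs where "Hs i j = (\<Sum>m<M. partial_deriv i (partial_deriv j (loglik1 p (xs m))) \<theta>)" for i j
  let ?F = "fisher \<nu> p \<theta>"
  \<comment> \<open>The score sum vanishes at \<open>t\<close>, leaving its expansion at
    \<open>\<theta>\<close>. The level \<open>\<eta> / (d * \<epsilon>)\<close> in
    \<open>sumB\<close> turns the remainder, quadratic in \<open>\<epsilon>\<close>, into one of
    size \<open>\<epsilon> * \<eta>\<close>.\<close>
  have T: "\<bar>s j + (\<Sum>i\<in>UNIV. v $ i * Hs i j)\<bar> \<le> real M * (d * \<epsilon> * \<eta>)" for j
  proof -
    let ?r = "\<lambda>m. partial_deriv j (loglik1 p (xs m)) t - partial_deriv j (loglik1 p (xs m)) \<theta>
        - (\<Sum>i\<in>UNIV. (t $ i - \<theta> $ i) * partial_deriv i (partial_deriv j (loglik1 p (xs m))) \<theta>)"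
    have "\<bar>?r m\<bar> \<le> d\<^sup>2 * \<epsilon>\<^sup>2 * b m" if "m < M" for m
      unfolding d_def
    proof (rule first_order_taylor_bound[OF S R1(1)])
      show "S \<subseteq> \<Theta>'" using Sball ball by blast
      show "Ck_on 2 (partial_deriv j (loglik1 p (xs m))) \<Theta>'"
        using derivs_differentiable(4)[OF x[OF that]] \<theta> R1(2) by blast
      fix z i k assume z: "z \<in> S"
      then show "\<bar>z $ i - \<theta> $ i\<bar> \<le> \<epsilon>" by (simp add: S_def)
      show "\<bar>partial_deriv k (partial_deriv i (partial_deriv j (loglik1 p (xs m)))) z\<bar> \<le> b m"
        using B[OF x[OF that], of z k i j] z Sball b0 by (auto simp: b[OF that])
    qed
    then have "\<bar>\<Sum>m<M. ?r m\<bar> \<le> (\<Sum>m<M. d\<^sup>2 * \<epsilon>\<^sup>2 * b m)"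
      by (intro sum_abs[THEN order_trans] sum_mono) auto
    also have "\<dots> = d\<^sup>2 * \<epsilon>\<^sup>2 * (\<Sum>m<M. b m)" by (simp add: sum_distrib_left)
    also have "\<dots> \<le> d\<^sup>2 * \<epsilon>\<^sup>2 * (real M * (\<eta> / (d * \<epsilon>)))"
      using sumb by (intro mult_left_mono) auto
    also have "\<dots> = real M * (d * \<epsilon> * \<eta>)"
      using d \<epsilon> by (simp add: field_simps power2_eq_square)
    also have "(\<Sum>m<M. ?r m) = - (s j + (\<Sum>i\<in>UNIV. v $ i * Hs i j))"
      using mle_stationary(2)[OF M xs, of j]
      by (simp add: sum_subtractf t_def[symmetric] s_def Hs_def v_def sum_distrib_left sum.swap[of _ "{..<M}"])
    finally show ?thesis by (simp only: abs_minus_cancel)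
  qed
  \<comment> \<open>Replacing the Hessian sum by \<open>- M F\<close> costs the same error again,
    hence the factor 2.\<close>
  have N: "\<bar>s j - real M * (\<Sum>i\<in>UNIV. v $ i * ?F $ i $ j)\<bar> \<le> 2 * real M * (d * \<epsilon> * \<eta>)" for j
  proof -
    have "\<bar>\<Sum>i\<in>UNIV. v $ i * (Hs i j + real M * ?F $ i $ j)\<bar> \<le> (\<Sum>i\<in>(UNIV::'d set). \<epsilon> * (real M * \<eta>))"
    proof (intro sum_abs[THEN order_trans] sum_mono)
      fix i show "\<bar>v $ i * (Hs i j + real M * ?F $ i $ j)\<bar> \<le> \<epsilon> * (real M * \<eta>)"
        unfolding abs_mult Hs_def using v hess[of i j] \<epsilon> by (intro mult_mono) auto
    qed
    also have "\<dots> = real M * (d * \<epsilon> * \<eta>)" by (simp add: d_def)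
    finally have "\<bar>(\<Sum>i\<in>UNIV. v $ i * Hs i j) + real M * (\<Sum>i\<in>UNIV. v $ i * ?F $ i $ j)\<bar> \<le> real M * (d * \<epsilon> * \<eta>)"
      by (simp add: distrib_left sum.distrib sum_distrib_left mult_ac)
    with T[of j] show ?thesis by linarith
  qed
  \<comment> \<open>Weighting the equations by \<open>u\<close> isolates one coordinate of the error
    because \<open>F u\<close> is a basis vector.\<close>
  have "(\<Sum>j\<in>UNIV. u $ j * (\<Sum>i\<in>UNIV. v $ i * ?F $ i $ j)) = (\<Sum>i\<in>UNIV. v $ i * (?F *v u) $ i)"
    by (simp add: matrix_vector_mult_def sum_distrib_left mult_ac) (rule sum.swap)
  also have "\<dots> = v $ a"
    unfolding u by (rule sum_mult_axis)
  finally have va: "(\<Sum>j\<in>UNIV. u $ j * (\<Sum>i\<in>UNIV. v $ i * ?F $ i $ j)) = v $ a" .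
  have us: "(\<Sum>m<M. u \<bullet> score \<theta> (xs m)) = (\<Sum>j\<in>UNIV. u $ j * s j)"
    by (simp add: inner_vec_def gradient_def s_def sum_distrib_left sum.swap[of _ "{..<M}"])
  have "\<bar>\<Sum>j\<in>UNIV. u $ j * (s j - real M * (\<Sum>i\<in>UNIV. v $ i * ?F $ i $ j))\<bar>
      \<le> (\<Sum>j\<in>UNIV. \<bar>u $ j\<bar> * (2 * real M * (d * \<epsilon> * \<eta>)))"
    by (intro sum_abs[THEN order_trans] sum_mono) (auto simp: abs_mult intro!: mult_left_mono N)
  also have "(\<Sum>j\<in>UNIV. u $ j * (s j - real M * (\<Sum>i\<in>UNIV. v $ i * ?F $ i $ j)))
      = (\<Sum>j\<in>UNIV. u $ j * s j) - real M * v $ a"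
    unfolding va[symmetric] by (simp add: right_diff_distrib sum_subtractf sum_distrib_left mult_ac)
  finally have "\<bar>(\<Sum>j\<in>UNIV. u $ j * s j) - real M * v $ a\<bar> \<le> (\<Sum>j\<in>UNIV. \<bar>u $ j\<bar>) * (2 * real M * (d * \<epsilon> * \<eta>))"
    by (simp add: sum_distrib_right)
  moreover have "\<bar>real M * v $ a\<bar> \<le> real M * \<epsilon>"
    unfolding abs_mult using v[of a] by (intro mult_mono) auto
  ultimately have "\<bar>\<Sum>j\<in>UNIV. u $ j * s j\<bar> \<le> real M * \<epsilon> + (\<Sum>j\<in>UNIV. \<bar>u $ j\<bar>) * (2 * real M * (d * \<epsilon> * \<eta>))"
    by linarith
  then show ?thesis unfolding us d_def by (simp add: algebra_simps)
qed

section \<open>Failure of the guarantee when there are too few repetitions\<close>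

text \<open>A non-measurable set has measure \<open>0\<close> in Isabelle, so the guarantee entails measurability of its
  event when \<open>\<delta> < 1\<close>.\<close>

lemma mle_guarantee_sequences:
  assumes g: "mle_guarantee \<nu> p \<Theta> \<delta> \<epsilon> M" and \<theta>: "\<theta> \<in> \<Theta>" and "\<delta> < 1"
  defines "P \<equiv> \<Pi>\<^sub>M j\<in>(UNIV::nat set). law \<nu> p \<theta>"
  obtains G where "G \<in> sets P" "1 - \<delta> \<le> measure P G"
    "\<And>\<omega>. \<omega> \<in> G \<Longrightarrow> restrict \<omega> {..<M} \<in> samples \<nu> M"
    "\<And>\<omega>. \<omega> \<in> G \<Longrightarrow> infnorm (mle p \<Theta> M (restrict \<omega> {..<M}) - \<theta>) \<le> \<epsilon>"
proof -
  let ?L = "law \<nu> p \<theta>" and ?r = "\<lambda>\<omega>. restrict \<omega> {..<M}"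
  let ?S = "{xs \<in> samples \<nu> M. infnorm (mle p \<Theta> M xs - \<theta>) \<le> \<epsilon>}"
  have S: "1 - \<delta> \<le> measure (sample_law \<nu> p M \<theta>) ?S"
    using g \<theta> unfolding mle_guarantee_def by blast
  then have sets: "?S \<in> sets (sample_law \<nu> p M \<theta>)"
    using \<open>\<delta> < 1\<close> measure_notin_sets[of ?S "sample_law \<nu> p M \<theta>"] by fastforce
  \<comment> \<open>Keeping the first \<open>M\<close> coordinates is a reindexing of the product
    along \<open>id\<close>, which pushes \<open>P\<close> forward to the law of the sample.\<close>
  have "sample_law \<nu> p M \<theta> = distr P (sample_law \<nu> p M \<theta>) ?r"
    using distr_PiM_reindex[of UNIV "\<lambda>_. ?L" id "{..<M}"] prob[OF \<theta>]
    by (simp add: sample_law_def P_def restrict_def)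
  moreover have r: "?r \<in> measurable P (sample_law \<nu> p M \<theta>)"
    unfolding sample_law_def P_def by measurable
  ultimately have "measure (sample_law \<nu> p M \<theta>) ?S = measure P (?r -` ?S \<inter> space P)"
    using measure_distr[OF r sets] by simp
  then show thesis
    using S measurable_sets[OF r sets] by (intro that[of "?r -` ?S \<inter> space P"]) auto
qed

text \<open>One parameter suffices to refute a guarantee over all of \<open>\<Theta>\<close>, so
  \<open>\<theta>\<close> stays fixed and the limit theorems need no uniformity in it.\<close>

lemma mle_guarantee_fails:
  assumes \<delta>: "\<delta> < 1" and w: "1 < w" "exp (- (sqrt w)\<^sup>2 / 2) / (2 * sqrt w * sqrt (2 * pi)) = \<delta>"
    and \<theta>: "\<theta> \<in> \<Theta>" and \<kappa>: "0 < \<kappa>" "\<kappa> < w * fisher_inv \<nu> p \<theta> $ a $ a"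
  shows "\<forall>\<^sub>F \<epsilon> in at_right 0. \<not> mle_guarantee \<nu> p \<Theta> \<delta> \<epsilon> (nat \<lceil>\<kappa> / \<epsilon>\<^sup>2\<rceil>)"
proof -
  let ?L = "law \<nu> p \<theta>" and ?P = "\<Pi>\<^sub>M j\<in>(UNIV::nat set). law \<nu> p \<theta>"
  interpret L: prob_space ?L by (rule prob[OF \<theta>])
  interpret P: prob_space ?P by (rule L.prob_space_sequences)
  define u where "u = fisher_inv \<nu> p \<theta> *v axis a 1"
  note Fu = fisher_inv_column[OF \<theta>, of a, folded u_def]
  define \<sigma> where "\<sigma> = sqrt (fisher_inv \<nu> p \<theta> $ a $ a)"
  have \<sigma>: "0 < \<sigma>" "\<sigma>\<^sup>2 = fisher_inv \<nu> p \<theta> $ a $ a"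
    using fisher_inv_diagonal_pos[OF \<theta>, of a] by (simp_all add: \<sigma>_def)
  define d where "d = real CARD('d)"
  have d: "0 < d" by (simp add: d_def)
  define U where "U = (\<Sum>j\<in>UNIV. \<bar>u $ j\<bar>)"
  have U: "0 \<le> U" unfolding U_def by (intro sum_nonneg) auto

  have "sqrt \<kappa> / \<sigma> < sqrt w"
    using \<kappa> \<sigma> w real_sqrt_less_mono[OF \<kappa>(2)] by (simp add: field_simps real_sqrt_mult \<sigma>_def)
  then have "max 1 (sqrt \<kappa> / \<sigma>) < sqrt w" using w by simp
  \<comment> \<open>All three strict inequalities matter: \<open>t > 1\<close> for the tail bound,
    \<open>t > sqrt \<kappa> / \<sigma>\<close> as room for the expansion error, and
    \<open>t < sqrt w\<close> for a tail strictly above \<open>\<delta>\<close>.\<close>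
  then obtain t where t: "max 1 (sqrt \<kappa> / \<sigma>) < t" "t < sqrt w" using dense by blast
  have t1: "1 < t" "sqrt \<kappa> < t * \<sigma>" using t \<sigma> by (simp_all add: field_simps)
  define \<rho> where "\<rho> = t * \<sigma> / sqrt \<kappa>"
  have \<rho>: "1 < \<rho>" using t1 \<kappa> by (simp add: \<rho>_def)
  \<comment> \<open>The relative error \<open>2 * d * U * \<eta>\<close> of the expansion must stay
    below \<open>\<rho> - 1\<close>; adding 1 to the denominator secures both positivity and
    strictness.\<close>
  define \<eta> where "\<eta> = (\<rho> - 1) / (2 * d * U + 1)"
  have den: "0 < 2 * d * U + 1" using d U by (simp add: add_nonneg_pos)
  have \<eta>: "0 < \<eta>" using \<rho> den by (simp add: \<eta>_def)
  have "2 * d * U * \<eta> < (2 * d * U + 1) * \<eta>" using \<eta> by simp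
  also have "\<dots> = \<rho> - 1" using den by (simp add: \<eta>_def)
  finally have sl: "sqrt \<kappa> * (1 + 2 * d * U * \<eta>) < t * \<sigma>"
    using \<kappa> by (simp add: \<rho>_def field_simps)

  obtain B where B: "B \<in> borel_measurable \<nu>" "(\<integral>\<^sup>+x. B x \<partial>?L) < \<infinity>"
    "\<And>x y i j k. x \<in> space \<nu> \<Longrightarrow> y \<in> ball \<theta> r\<^sub>0 \<Longrightarrow>
       ennreal \<bar>partial_deriv i (partial_deriv j (partial_deriv k (loglik1 p x))) y\<bar> \<le> B x"
    using third_deriv_envelope[OF \<theta>] by blast
  have [measurable]: "B \<in> borel_measurable ?L" using B(1) by simp
  define Y where "Y x = u \<bullet> score \<theta> x" for x
  define h where "h i j x = partial_deriv i (partial_deriv j (loglik1 p x)) \<theta>" for i j x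
  have [measurable]: "Y \<in> borel_measurable ?L"
    unfolding Y_def by (rule score_direction(1)[OF \<theta>])
  have h_int: "integrable ?L (h i j)" for i j
    unfolding h_def by (rule hessian_entry(1)[OF \<theta>])
  then have [measurable]: "h i j \<in> borel_measurable ?L" for i j by (rule borel_measurable_integrable)

  define M where "M \<epsilon> = nat \<lceil>\<kappa> / \<epsilon>\<^sup>2\<rceil>" for \<epsilon> :: real
  \<comment> \<open>Only the upper tail is excluded. This enlarges the success event, and its
    limiting probability \<open>\<Phi>(t)\<close> is what the one-tailed equation for
    \<open>w\<close> is made for.\<close>
  define A where "A n = {\<omega> \<in> space ?P. (\<Sum>m<n. Y (\<omega> m)) \<le> t * \<sigma> * sqrt (real n)}" for n
  define Hb where "Hb i j n = {\<omega> \<in> space ?P.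
      real n * \<eta> \<le> \<bar>(\<Sum>m<n. h i j (\<omega> m)) - real n * L.expectation (h i j)\<bar>}" for i j n
  \<comment> \<open>The level for the average of \<open>B\<close> grows like
    \<open>1 / \<epsilon>\<close>, so its Markov bound vanishes with
    \<open>\<epsilon>\<close>.\<close>
  define Tb where "Tb \<epsilon> = {\<omega> \<in> space ?P.
      ennreal (real (M \<epsilon>) * (\<eta> / (d * \<epsilon>))) \<le> (\<Sum>m<M \<epsilon>. B (\<omega> m))}" for \<epsilon>
  define E where "E = enn2real (\<integral>\<^sup>+x. B x \<partial>?L)"
  have [measurable]: "A n \<in> sets ?P" "Hb i j n \<in> sets ?P" "Tb \<epsilon> \<in> sets ?P" for n i j \<epsilon>
    unfolding A_def Hb_def Tb_def by measurable
  \<comment> \<open>Turns limits in the sample size into limits as \<open>\<epsilon>\<close> tends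
    to 0.\<close>
  have M: "filterlim M sequentially (at_right 0)"
    unfolding filterlim_sequentially_iff_filterlim_real
  proof (rule filterlim_at_top_mono)
    show "filterlim (\<lambda>\<epsilon>. \<kappa> / \<epsilon>\<^sup>2) at_top (at_right 0)" using \<kappa> by real_asymp
    show "\<forall>\<^sub>F \<epsilon> in at_right 0. \<kappa> / \<epsilon>\<^sup>2 \<le> real (M \<epsilon>)"
      unfolding M_def by (intro always_eventually allI of_nat_ceiling)
  qed
  have lim: "((\<lambda>\<epsilon>. P.prob (A (M \<epsilon>)) + (\<Sum>i\<in>UNIV. \<Sum>j\<in>UNIV. P.prob (Hb i j (M \<epsilon>))) + E / (\<eta> / (d * \<epsilon>)))
      \<longlongrightarrow> cdf std_normal_distribution t + (\<Sum>i\<in>(UNIV::'d set). \<Sum>j\<in>(UNIV::'d set). 0) + 0) (at_right 0)"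
  proof (intro tendsto_add tendsto_sum)
    have "(\<lambda>n. P.prob (A n)) \<longlonglongrightarrow> cdf std_normal_distribution t"
      unfolding A_def
      by (rule L.central_limit_cdf)
        (use \<sigma> score_direction[OF \<theta>, of u] Fu in \<open>simp_all add: Y_def[abs_def]\<close>)
    from filterlim_compose[OF this M] show "((\<lambda>\<epsilon>. P.prob (A (M \<epsilon>))) \<longlongrightarrow> cdf std_normal_distribution t) (at_right 0)" .
    show "((\<lambda>\<epsilon>. P.prob (Hb i j (M \<epsilon>))) \<longlongrightarrow> 0) (at_right 0)" for i j
      using filterlim_compose[OF L.weak_law_of_large_numbers[OF h_int \<eta>] M] unfolding Hb_def .
    have "((\<lambda>\<epsilon>. E * d / \<eta> * \<epsilon>) \<longlongrightarrow> E * d / \<eta> * 0) (at_right 0)"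
      by (intro tendsto_intros)
    then show "((\<lambda>\<epsilon>. E / (\<eta> / (d * \<epsilon>))) \<longlongrightarrow> 0) (at_right 0)" by (simp add: mult_ac)
  qed
  have "cdf std_normal_distribution t \<le> 1 - exp (- t\<^sup>2 / 2) / (2 * t * sqrt (2 * pi))"
    using t1 by (intro cdf_std_normal_le) simp
  also have "\<dots> < 1 - \<delta>"
  proof -
    have "t\<^sup>2 < (sqrt w)\<^sup>2" using t t1 by (intro power_strict_mono) auto
    then have "exp (- (sqrt w)\<^sup>2 / 2) / (2 * sqrt w * sqrt (2 * pi)) < exp (- t\<^sup>2 / 2) / (2 * t * sqrt (2 * pi))"
      using t t1 by (intro frac_less) auto
    then show ?thesis unfolding w(2) by simp
  qed
  finally have ev: "\<forall>\<^sub>F \<epsilon> in at_right 0.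
      P.prob (A (M \<epsilon>)) + (\<Sum>i\<in>UNIV. \<Sum>j\<in>UNIV. P.prob (Hb i j (M \<epsilon>))) + E / (\<eta> / (d * \<epsilon>)) < 1 - \<delta>"
    by (intro order_tendstoD(2)[OF lim]) simp
  \<comment> \<open>Rounding up makes \<open>M * \<epsilon>\<^sup>2\<close> as large as
    \<open>\<kappa> + \<epsilon>\<^sup>2\<close>; the slack in \<open>sl\<close> absorbs
    this.\<close>
  have "((\<lambda>\<epsilon>. sqrt (\<kappa> + \<epsilon>\<^sup>2) * (1 + 2 * d * U * \<eta>)) \<longlongrightarrow> sqrt (\<kappa> + 0\<^sup>2) * (1 + 2 * d * U * \<eta>)) (at_right 0)"
    by (intro tendsto_intros)
  then have slack: "\<forall>\<^sub>F \<epsilon> in at_right 0. sqrt (\<kappa> + \<epsilon>\<^sup>2) * (1 + 2 * d * U * \<eta>) < t * \<sigma>"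
    by (rule order_tendstoD) (use sl in simp)
  have small: "\<forall>\<^sub>F \<epsilon> in at_right 0. 0 < \<epsilon> \<and> \<epsilon> < r\<^sub>0 / d"
    using eventually_at_right_real[of 0 "r\<^sub>0 / d"] R1(3) d by simp
  from ev slack small show ?thesis
  proof eventually_elim
    case (elim \<epsilon>)
    let ?M = "M \<epsilon>"
    have \<epsilon>: "0 < \<epsilon>" "d * \<epsilon> < r\<^sub>0" using elim d by (auto simp: field_simps)
    have "0 < \<kappa> / \<epsilon>\<^sup>2" using \<kappa> \<epsilon> by simp
    then have M1: "1 \<le> ?M" and M2: "real ?M \<le> \<kappa> / \<epsilon>\<^sup>2 + 1"
      unfolding M_def by linarith+
    have M3: "real ?M * \<epsilon> * (1 + 2 * d * U * \<eta>) \<le> t * \<sigma> * sqrt (real ?M)"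
    proof -
      have "real ?M * \<epsilon>\<^sup>2 \<le> \<kappa> + \<epsilon>\<^sup>2" using M2 \<epsilon> by (simp add: field_simps)
      then have "sqrt (real ?M) * \<epsilon> \<le> sqrt (\<kappa> + \<epsilon>\<^sup>2)"
        using \<epsilon> real_sqrt_le_mono[of "real ?M * \<epsilon>\<^sup>2" "\<kappa> + \<epsilon>\<^sup>2"] by (simp add: real_sqrt_mult)
      then have "sqrt (real ?M) * \<epsilon> * (1 + 2 * d * U * \<eta>) \<le> sqrt (\<kappa> + \<epsilon>\<^sup>2) * (1 + 2 * d * U * \<eta>)"
        using d U \<eta> by (intro mult_right_mono) auto
      also have "\<dots> \<le> t * \<sigma>" using elim by simp
      finally have le: "sqrt (real ?M) * \<epsilon> * (1 + 2 * d * U * \<eta>) \<le> t * \<sigma>" .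
      have "real ?M * \<epsilon> * (1 + 2 * d * U * \<eta>) = sqrt (real ?M) * \<epsilon> * (1 + 2 * d * U * \<eta>) * sqrt (real ?M)"
        by simp
      also have "\<dots> \<le> t * \<sigma> * sqrt (real ?M)"
        by (rule mult_right_mono[OF le]) simp
      finally show ?thesis .
    qed
    show ?case
    proof
      assume "mle_guarantee \<nu> p \<Theta> \<delta> \<epsilon> (nat \<lceil>\<kappa> / \<epsilon>\<^sup>2\<rceil>)"
      from mle_guarantee_sequences[OF this[folded M_def] \<theta> \<delta>] obtain G where G: "G \<in> sets ?P" "1 - \<delta> \<le> P.prob G"
        "\<And>\<omega>. \<omega> \<in> G \<Longrightarrow> restrict \<omega> {..<?M} \<in> samples \<nu> ?M"
        "\<And>\<omega>. \<omega> \<in> G \<Longrightarrow> infnorm (mle p \<Theta> ?M (restrict \<omega> {..<?M}) - \<theta>) \<le> \<epsilon>"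
        by blast
      let ?bad = "(\<Union>i. \<Union>j. Hb i j ?M) \<union> Tb \<epsilon>"
      \<comment> \<open>Outside the bad events every hypothesis of \<open>score_expansion\<close>
        holds, and \<open>M3\<close> fits its bound under the central limit threshold.\<close>
      have "G \<subseteq> A ?M \<union> ?bad"
      proof
        fix \<omega> assume \<omega>: "\<omega> \<in> G"
        have sp: "\<omega> \<in> space ?P" using \<omega> G(1) sets.sets_into_space by blast
        show "\<omega> \<in> A ?M \<union> ?bad"
        proof (cases "\<omega> \<in> ?bad")
          case False
          have "\<bar>\<Sum>m<?M. u \<bullet> score \<theta> (restrict \<omega> {..<?M} m)\<bar>
              \<le> real ?M * \<epsilon> * (1 + 2 * real CARD('d) * (\<Sum>j\<in>UNIV. \<bar>u $ j\<bar>) * \<eta>)"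
          proof (rule score_expansion[OF \<theta> M1 G(3)[OF \<omega>] G(4)[OF \<omega>] \<epsilon>(1) \<epsilon>(2)[unfolded d_def] B(3)])
            show "(\<Sum>m<?M. B (restrict \<omega> {..<?M} m)) < ennreal (real ?M * (\<eta> / (real CARD('d) * \<epsilon>)))"
              using False sp by (auto simp: Tb_def d_def)
            fix i j
            have "\<omega> \<notin> Hb i j ?M" using False by blast
            then show "\<bar>(\<Sum>m<?M. partial_deriv i (partial_deriv j (loglik1 p (restrict \<omega> {..<?M} m))) \<theta>)
                + real ?M * fisher \<nu> p \<theta> $ i $ j\<bar> < real ?M * \<eta>"
              using sp hessian_entry(2)[OF \<theta>, of i j]
              by (simp add: Hb_def h_def[abs_def] not_le)
          qed (use \<eta> Fu in auto)
          then have "(\<Sum>m<?M. Y (\<omega> m)) \<le> real ?M * \<epsilon> * (1 + 2 * d * U * \<eta>)"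
            by (simp add: Y_def d_def U_def)
          with M3 have "\<omega> \<in> A ?M" using sp by (simp add: A_def)
          then show ?thesis ..
        qed auto
      qed
      then have "P.prob G \<le> P.prob (A ?M \<union> ?bad)"
        by (intro P.finite_measure_mono) auto
      also have "\<dots> \<le> P.prob (A ?M) + (P.prob (\<Union>i. \<Union>j. Hb i j ?M) + P.prob (Tb \<epsilon>))"
        by (intro measure_Un_le[THEN order_trans] add_left_mono measure_Un_le) auto
      also have "P.prob (\<Union>i. \<Union>j. Hb i j ?M) \<le> (\<Sum>i\<in>UNIV. \<Sum>j\<in>UNIV. P.prob (Hb i j ?M))"
        by (intro P.finite_measure_subadditive_finite[THEN order_trans] sum_mono) auto
      also have "P.prob (Tb \<epsilon>) \<le> E / (\<eta> / (d * \<epsilon>))"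
        unfolding Tb_def E_def using B(2) \<eta> d \<epsilon> M1 by (intro L.tail_average_le) auto
      finally have "P.prob G < 1 - \<delta>" using elim by simp
      with G(2) show False by simp
    qed
  qed
qed

text \<open>Since \<open>c * S\<close> lies below the supremum, some \<open>\<theta>\<close> and
  \<open>a\<close> have a diagonal entry above it, and the failure result applies with
  \<open>\<kappa> = c * W * S\<close>. The supremum need not be attained.\<close>

lemma min_reps_asymptotic:
  assumes \<delta>: "0 < \<delta>" "\<delta> < 1 / sqrt (8 * pi * exp 1)"
  defines "W \<equiv> lambert_W0 (\<delta> powi (-2) / (8 * pi))"
    and "S \<equiv> (SUP \<theta>\<in>\<Theta>. MAX a. fisher_inv \<nu> p \<theta> $ a $ a)"
  shows "0 < W * S"
    and "0 < c \<Longrightarrow> c < 1 \<Longrightarrow>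
      \<forall>\<^sub>F \<epsilon> in at_right 0. ereal (c * (W * S * \<epsilon> powi (-2))) \<le> ereal_of_enat (min_reps \<nu> p \<Theta> \<delta> \<epsilon>)"
proof -
  note w = lambert_W0_error_probability[OF \<delta>, folded W_def]
  have "1 * 1 \<le> (8 * pi) * exp (1::real)"
    using pi_gt3 by (intro mult_mono) auto
  then have "1 / sqrt (8 * pi * exp 1) \<le> 1" by simp
  with \<delta> have \<delta>1: "\<delta> < 1" by linarith
  have "0 < S"
  proof -
    obtain \<theta> where \<theta>: "\<theta> \<in> \<Theta>" using nonempty by blast
    have "0 < fisher_inv \<nu> p \<theta> $ undefined $ undefined" by (rule fisher_inv_diagonal_pos[OF \<theta>])
    also have "\<dots> \<le> (MAX a. fisher_inv \<nu> p \<theta> $ a $ a)" by (intro Max_ge) auto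
    also have "\<dots> \<le> S" unfolding S_def by (intro cSUP_upper \<theta> bdd_above_fisher_inv_diagonal)
    finally show ?thesis .
  qed
  with w show WS: "0 < W * S" by simp
  assume c: "0 < c" "c < 1"
  have "c * S < S" using c \<open>0 < S\<close> by simp
  then obtain \<theta> where \<theta>: "\<theta> \<in> \<Theta>" "c * S < (MAX a. fisher_inv \<nu> p \<theta> $ a $ a)"
    unfolding S_def using less_cSUP_iff[OF nonempty bdd_above_fisher_inv_diagonal] by blast
  then obtain a where a: "c * S < fisher_inv \<nu> p \<theta> $ a $ a"
    by (subst (asm) Max_gr_iff) auto
  have \<kappa>: "0 < c * (W * S)" "c * (W * S) < W * fisher_inv \<nu> p \<theta> $ a $ a"
    using c WS a w by simp_all
  show "\<forall>\<^sub>F \<epsilon> in at_right 0. ereal (c * (W * S * \<epsilon> powi (-2))) \<le> ereal_of_enat (min_reps \<nu> p \<Theta> \<delta> \<epsilon>)"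
    using mle_guarantee_fails[OF \<delta>1 w \<theta>(1) \<kappa>]
  proof eventually_elim
    case (elim \<epsilon>)
    have "ereal (c * (W * S * \<epsilon> powi (-2))) \<le> ereal (real (nat \<lceil>c * (W * S) / \<epsilon>\<^sup>2\<rceil>))"
      using of_nat_ceiling[of "c * (W * S) / \<epsilon>\<^sup>2"]
      by (simp add: power_int_minus divide_inverse mult_ac)
    also have "\<dots> \<le> ereal_of_enat (min_reps \<nu> p \<Theta> \<delta> \<epsilon>)"
      using min_reps_ge[OF elim] by (metis ereal_of_enat_le_iff ereal_of_enat_simps(1))
    finally show ?case .
  qed
qed

end

theorem theorem2:
  fixes \<nu> :: "'x measure" and p :: "real^'d::finite \<Rightarrow> 'x \<Rightarrow> real"
    and \<Theta> \<Theta>' :: "(real^'d) set" and r\<^sub>0 \<delta> :: real and N\<^sub>\<E> :: nat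
  assumes "regular_model \<nu> p \<Theta> \<Theta>' r\<^sub>0"
    and "0 < \<delta>" and "\<delta> < 1 / sqrt (8 * pi * exp 1)"
    and "1 \<le> N\<^sub>\<E>"
  shows "asymp_ge (\<lambda>\<epsilon>. ereal_of_enat (min_reps \<nu> p \<Theta> \<delta> \<epsilon>))
           (\<lambda>\<epsilon>. lambert_W0 (\<delta> powi (-2) / (8 * pi))
                * (SUP \<theta>\<in>\<Theta>. MAX a. fisher_inv \<nu> p \<theta> $ a $ a) * \<epsilon> powi (-2))
         \<and> asymp_ge (\<lambda>\<epsilon>. ereal_of_enat (min_sample_complexity N\<^sub>\<E> \<nu> p \<Theta> \<delta> \<epsilon>))
               (\<lambda>\<epsilon>. real N\<^sub>\<E> * lambert_W0 (\<delta> powi (-2) / (8 * pi))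
                    * (SUP \<theta>\<in>\<Theta>. MAX a. fisher_inv \<nu> p \<theta> $ a $ a) * \<epsilon> powi (-2))"
    (is "asymp_ge ?m (\<lambda>\<epsilon>. ?W * ?S * \<epsilon> powi (-2)) \<and> _")
proof -
  interpret regular_model \<nu> p \<Theta> \<Theta>' r\<^sub>0 by fact
  note * = min_reps_asymptotic[OF assms(2,3)]
  have pos: "\<forall>\<^sub>F \<epsilon> in at_right 0. 0 < ?W * ?S * \<epsilon> powi (-2)"
    using eventually_at_right_less[of "0::real"]
    by eventually_elim (use *(1) in \<open>simp add: power_int_minus\<close>)
  have "asymp_ge ?m (\<lambda>\<epsilon>. ?W * ?S * \<epsilon> powi (-2))"
    by (rule asymp_geI[OF pos *(2)])
  moreover have "asymp_ge (\<lambda>\<epsilon>. ereal_of_enat (min_sample_complexity N\<^sub>\<E> \<nu> p \<Theta> \<delta> \<epsilon>))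
      (\<lambda>\<epsilon>. real N\<^sub>\<E> * ?W * ?S * \<epsilon> powi (-2))"
  proof (rule asymp_geI)
    show "\<forall>\<^sub>F \<epsilon> in at_right 0. 0 < real N\<^sub>\<E> * ?W * ?S * \<epsilon> powi (-2)"
      using pos
    proof eventually_elim
      case (elim \<epsilon>)
      then have "0 < real N\<^sub>\<E> * (?W * ?S * \<epsilon> powi (-2))" using assms(4) by simp
      then show ?case by (simp only: mult.assoc)
    qed
    fix c :: real assume "0 < c" "c < 1"
    from *(2)[OF this]
    show "\<forall>\<^sub>F \<epsilon> in at_right 0. ereal (c * (real N\<^sub>\<E> * ?W * ?S * \<epsilon> powi (-2)))
        \<le> ereal_of_enat (min_sample_complexity N\<^sub>\<E> \<nu> p \<Theta> \<delta> \<epsilon>)"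
    proof eventually_elim
      case (elim \<epsilon>)
      then have "ereal (real N\<^sub>\<E>) * ereal (c * (?W * ?S * \<epsilon> powi (-2))) \<le> ereal (real N\<^sub>\<E>) * ?m \<epsilon>"
        by (intro ereal_mult_left_mono) auto
      then show ?case
        by (simp add: min_sample_complexity_def ereal_of_enat_mult mult_ac)
    qed
  qed
  ultimately show ?thesis ..
qed

end
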